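(* Let $n\in\mathbb{N}$, let $\zeta_1,\ldots,\zeta_n\in\mathbb{T}$ be distinct, let $m_1,\ldots,m_n\in\mathbb{N}$, and let $a(z)=\prod_{j=1}^n(z-\zeta_j)^{m_j}$. Then $$\mathscr{M}(\overline{a})=\mathscr{M}(a)\oplus_{\overline{a}}\operatorname{span}\{k_{\zeta_j,\ell}^{\overline{a}}:\ j=1,\ldots,n,\ \ell=0,\ldots,m_j-1\}.$$
   Context: $\mathbb{T}$ is the unit circle, $\mathbb{N}=\{1,2,\ldots\}$, $H^2$ the Hardy space of the open unit disk with $\langle f,g\rangle_{H^2}=\int_{\mathbb{T}}f\overline{g}\,dm$ ($m$ normalized Lebesgue measure). For $\varphi\in L^\infty(\mathbb{T})$, $T_\varphi f=P_+(\varphi f)$ on $H^2$, with $P_+:L^2\to H^2$ the orthogonal projection. The polynomial $a$ is outer and $T_{\overline{a}}$ is injective; $\mathscr{M}(\overline{a}):=T_{\overline{a}}H^2$ with $\langle T_{\overline{a}}f,T_{\overline{a}}g\rangle_{\overline{a}}:=\langle f,g\rangle_{H^2}$, and $\mathscr{M}(a):=aH^2\subset\mathscr{M}(\overline{a})$. $\oplus_{\overline{a}}$ is the orthogonal sum with respect to $\langle\cdot,\cdot\rangle_{\overline{a}}$. For $0\leqslant\ell\leqslant m_j-1$, every $f\in\mathscr{M}(\overline{a})$ is such that $f^{(\ell)}$ has a finite non-tangential limit $f^{(\ell)}(\zeta_j)$ at $\zeta_j$, and $k_{\zeta_j,\ell}^{\overline{a}}\in\mathscr{M}(\overline{a})$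 is the element with $f^{(\ell)}(\zeta_j)=\langle f,k_{\zeta_j,\ell}^{\overline{a}}\rangle_{\overline{a}}$ for all $f\in\mathscr{M}(\overline{a})$; explicitly $k_{\zeta_j,\ell}^{\overline{a}}=T_{\overline{a}}\left(\ell!\,\frac{z^\ell a}{(1-\overline{\zeta_j}z)^{\ell+1}}\right)$. *)

theory Defs
  imports "HOL-Analysis.Analysis" "HOL-Library.Function_Algebras"
begin

section \<open>The unit circle and the Hardy space\<close>

text \<open>Normalized Lebesgue measure on the unit circle, as a measure on the complex
  plane carried by the circle.\<close>

definition circle_measure :: "complex measure" where
  "circle_measure = distr (uniform_measure lborel {0..2 * pi}) borel cis"

definition L2_circle :: "(complex \<Rightarrow> complex) set" where
  "L2_circle = {g \<in> borel_measurable borel. integrable circle_measure (\<lambda>w. (norm (g w))\<^sup>2)}"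

definition L2_inner :: "(complex \<Rightarrow> complex) \<Rightarrow> (complex \<Rightarrow> complex) \<Rightarrow> complex" where
  "L2_inner f g = (LINT w|circle_measure. f w * cnj (g w))"

text \<open>A function on the open unit disk is represented by its extension by zero to the
  whole plane, so that equality of such functions is equality in HOL.\<close>

definition H2 :: "(complex \<Rightarrow> complex) set" where
  "H2 = {f. f holomorphic_on ball 0 1 \<and> (\<forall>z. z \<notin> ball 0 1 \<longrightarrow> f z = 0) \<and>
     bdd_above ((\<lambda>r. LINT w|circle_measure. (norm (f (of_real r * w)))\<^sup>2) ` {0..<1})}"

text \<open>The boundary function of \<open>f\<close> is the limit in \<open>L\<^sup>2\<close> of the dilates \<open>w \<mapsto> f (r w)\<close> as
  \<open>r\<close> tends to \<open>1\<close> from the left. It is determined only almost everywhere; the choice of a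
  representative does not matter, since it is only used inside integrals.\<close>

definition is_boundary_function :: "(complex \<Rightarrow> complex) \<Rightarrow> (complex \<Rightarrow> complex) \<Rightarrow> bool" where
  "is_boundary_function f g \<longleftrightarrow> g \<in> L2_circle \<and>
     ((\<lambda>r. LINT w|circle_measure. (norm (f (of_real r * w) - g w))\<^sup>2) \<longlongrightarrow> 0) (at_left (1::real))"

definition boundary_function :: "(complex \<Rightarrow> complex) \<Rightarrow> complex \<Rightarrow> complex" where
  "boundary_function f = (SOME g. is_boundary_function f g)"

definition H2_inner :: "(complex \<Rightarrow> complex) \<Rightarrow> (complex \<Rightarrow> complex) \<Rightarrow> complex" where
  "H2_inner f g = L2_inner (boundary_function f) (boundary_function g)"


section \<open>Toeplitz operators and their range spaces\<close>

text \<open>The orthogonal projection of \<open>L\<^sup>2\<close> onto the Hardy space, the latter being viewed in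
  \<open>L\<^sup>2\<close> through boundary functions; the value is the function on the disk.\<close>

definition riesz_projection :: "(complex \<Rightarrow> complex) \<Rightarrow> complex \<Rightarrow> complex" where
  "riesz_projection g = (THE h. h \<in> H2 \<and>
     (\<forall>u\<in>H2. L2_inner (\<lambda>w. g w - boundary_function h w) (boundary_function u) = 0))"

text \<open>Only meaningful for a symbol \<open>\<phi>\<close> that is essentially bounded on the circle.\<close>

definition toeplitz :: "(complex \<Rightarrow> complex) \<Rightarrow> (complex \<Rightarrow> complex) \<Rightarrow> complex \<Rightarrow> complex" where
  "toeplitz \<phi> f = riesz_projection (\<lambda>w. \<phi> w * boundary_function f w)"

definition toeplitz_range :: "(complex \<Rightarrow> complex) \<Rightarrow> (complex \<Rightarrow> complex) set" where
  "toeplitz_range \<phi> = toeplitz \<phi> ` H2"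

text \<open>The range inner product; only meaningful when \<open>toeplitz \<phi>\<close> is injective on \<open>H2\<close> and
  both arguments lie in \<open>toeplitz_range \<phi>\<close>.\<close>

definition toeplitz_range_inner ::
    "(complex \<Rightarrow> complex) \<Rightarrow> (complex \<Rightarrow> complex) \<Rightarrow> (complex \<Rightarrow> complex) \<Rightarrow> complex" where
  "toeplitz_range_inner \<phi> f g =
     H2_inner (the_inv_into H2 (toeplitz \<phi>) f) (the_inv_into H2 (toeplitz \<phi>) g)"

definition multiplication_range :: "(complex \<Rightarrow> complex) \<Rightarrow> (complex \<Rightarrow> complex) set" where
  "multiplication_range a = (\<lambda>f z. a z * f z) ` H2"


section \<open>Non-tangential limits and the kernels at boundary points\<close>

definition stolz_region :: "real \<Rightarrow> complex \<Rightarrow> complex set" where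
  "stolz_region \<alpha> \<zeta> = {z. norm z < 1 \<and> norm (z - \<zeta>) < \<alpha> * (1 - norm z)}"

definition has_nontangential_limit :: "(complex \<Rightarrow> complex) \<Rightarrow> complex \<Rightarrow> complex \<Rightarrow> bool" where
  "has_nontangential_limit f L \<zeta> \<longleftrightarrow>
     (\<forall>\<alpha>>1. (f \<longlongrightarrow> L) (at \<zeta> within stolz_region \<alpha> \<zeta>))"

text \<open>The element of \<open>toeplitz_range \<phi>\<close> representing the functional that maps \<open>f\<close> to the
  non-tangential limit at \<open>\<zeta>\<close> of its derivative of order \<open>l\<close>.\<close>

definition boundary_kernel :: "(complex \<Rightarrow> complex) \<Rightarrow> complex \<Rightarrow> nat \<Rightarrow> complex \<Rightarrow> complex" where
  "boundary_kernel \<phi> \<zeta> l = (THE k. k \<in> toeplitz_range \<phi> \<and>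
     (\<forall>f\<in>toeplitz_range \<phi>.
        has_nontangential_limit ((deriv ^^ l) f) (toeplitz_range_inner \<phi> f k) \<zeta>))"


section \<open>Complex spans and orthogonal sums of function spaces\<close>

text \<open>The generic \<open>span\<close> on a type of class \<open>real_vector\<close> would be the real span.\<close>

definition complex_span :: "(complex \<Rightarrow> complex) set \<Rightarrow> (complex \<Rightarrow> complex) set" where
  "complex_span = module.span (\<lambda>c f z. c * f z)"

definition is_orthogonal_sum ::
    "((complex \<Rightarrow> complex) \<Rightarrow> (complex \<Rightarrow> complex) \<Rightarrow> complex) \<Rightarrow> (complex \<Rightarrow> complex) set \<Rightarrow>
     (complex \<Rightarrow> complex) set \<Rightarrow> (complex \<Rightarrow> complex) set \<Rightarrow> bool" where
  "is_orthogonal_sum ip V A B \<longleftrightarrow>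
     V = {f + g |f g. f \<in> A \<and> g \<in> B} \<and> A \<inter> B = {0} \<and> (\<forall>f\<in>A. \<forall>g\<in>B. ip f g = 0)"

end

theory Submission
  imports Defs "HOL-Probability.Probability_Measure" "HOL-Complex_Analysis.Complex_Analysis"
begin

text \<open>
  In terms of Taylor coefficients, \<open>H\<^sup>2\<close> is the space of square summable power series, and the
  co-analytic Toeplitz operator \<open>T\<close> with symbol \<open>cnj a\<close> is a polynomial in the backward shift.
  All zeros of \<open>a\<close> lie on the circle, so \<open>cnj (a z) = \<kappa> z\<^sup>-\<^sup>N a z\<close> there, with \<open>N\<close> the degree of \<open>a\<close>.
  Hence \<open>T (z\<^sup>N h) = \<kappa> a h\<close>, that is, the range of multiplication by \<open>a\<close> is the image of \<open>z\<^sup>N H\<^sup>2\<close>, and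
  its orthogonal complement is the image of the polynomials of degree less than \<open>N\<close>, which \<open>T\<close>
  maps to polynomials of degree less than \<open>N\<close>.

  Elements of \<open>H\<^sup>2\<close> grow at most like \<open>(1 - |z|)\<^sup>-\<^sup>1\<^sup>/\<^sup>2\<close>, so by Cauchy's estimates the derivatives of order
  less than \<open>m\<^sub>j\<close> of \<open>a h\<close> tend to \<open>0\<close> non-tangentially at \<open>\<zeta>\<^sub>j\<close>. This gives injectivity of \<open>T\<close> (if
  \<open>T f = 0\<close>, then \<open>a f\<close> is a polynomial of degree less than \<open>N\<close> divisible by \<open>a\<close>), and shows that the
  kernels are images of polynomials of degree less than \<open>N\<close>. They span all of these: the image of
  a polynomial orthogonal to their preimages vanishes at each \<open>\<zeta>\<^sub>j\<close> to order \<open>m\<^sub>j\<close> and has degree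
  less than \<open>N\<close>.
\<close>

section \<open>The normalized measure on the circle\<close>

lemma sets_circle_measure [measurable_cong, simp]: "sets circle_measure = sets borel"
  by (simp add: circle_measure_def)

lemma space_circle_measure [simp]: "space circle_measure = UNIV"
  by (simp add: circle_measure_def)

lemma borel_measurable_circle_iff [simp]:
  "f \<in> borel_measurable circle_measure \<longleftrightarrow> f \<in> borel_measurable borel"
  by (simp add: measurable_def)

lemma cis_borel_measurable [measurable]: "cis \<in> borel_measurable borel"
  by (intro borel_measurable_continuous_onI continuous_intros)

lemma cnj_borel_measurable [measurable]: "cnj \<in> borel_measurable borel"
  by (intro borel_measurable_continuous_onI continuous_intros)

lemma prob_space_circle_measure: "prob_space circle_measure"
  unfolding circle_measure_def
  by (intro prob_space.prob_space_distr prob_space_uniform_measure) auto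

interpretation circle: prob_space circle_measure
  by (rule prob_space_circle_measure)

lemma AE_circle_norm: "AE w in circle_measure. norm w = 1"
  unfolding circle_measure_def by (subst AE_distr_iff) auto

lemma integrable_circle_bounded:
  fixes f :: "complex \<Rightarrow> 'b::{banach, second_countable_topology}"
  assumes "f \<in> borel_measurable borel" "\<And>w. norm w = 1 \<Longrightarrow> norm (f w) \<le> B"
  shows "integrable circle_measure f"
proof (rule circle.integrable_const_bound[where B = B])
  show "AE w in circle_measure. norm (f w) \<le> B"
    using AE_circle_norm by eventually_elim (use assms in auto)
qed (use assms in measurable)

lemma integral_circle_eq:
  fixes f :: "complex \<Rightarrow> complex"
  assumes [measurable]: "f \<in> borel_measurable borel"
  shows "(LINT w|circle_measure. f w) =
    (LINT t|lborel. indicator {0..2*pi} t *\<^sub>R f (cis t)) / (2 * pi)"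
proof -
  have "(indicator {0..2*pi} t :: ennreal) / emeasure lborel {0..2*pi} =
      ennreal (indicator {0..2*pi} t / (2*pi))" for t
    by (auto simp: indicator_def divide_ennreal[of 1, simplified])
  then have "(LINT w|circle_measure. f w) =
      (LINT t|lborel. (indicator {0..2*pi} t / (2*pi)) *\<^sub>R f (cis t))"
    unfolding circle_measure_def uniform_measure_def
    by (subst integral_distr) (auto simp: integral_density)
  also have "\<dots> = (LINT t|lborel. inverse (2*pi) *\<^sub>R (indicator {0..2*pi} t *\<^sub>R f (cis t)))"
    by (intro Bochner_Integration.integral_cong) (auto simp: field_simps)
  finally show ?thesis
    by (simp add: scaleR_conv_of_real field_simps)
qed

text \<open>For \<open>k > 0\<close> the integrand has the antiderivative
  \<open>cis (k * t) / (\<i> * k)\<close>, which takes the same value at both ends of the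
  period.\<close>

lemma integral_circle_power:
  assumes "k > 0"
  shows "(LINT w|circle_measure. w ^ k) = 0"
proof -
  have "(LINT t|lborel. indicator {0..2*pi} t *\<^sub>R cis t ^ k) =
      cis (real k * (2*pi)) / (\<i> * k) - cis (real k * 0) / (\<i> * k)"
  proof (rule integral_FTC_Icc)
    fix t :: real
    have "((\<lambda>t. exp (\<i> * of_real (real k * t)) / (\<i> * k)) has_vector_derivative
        exp (\<i> * of_real (real k * t))) (at t within {0..2*pi})"
      using assms by (auto intro!: derivative_eq_intros has_vector_derivative_real_field simp: complex_eq_iff)
    then show "((\<lambda>t. cis (real k * t) / (\<i> * k)) has_vector_derivative cis t ^ k)
        (at t within {0..2*pi})"
      unfolding Complex.DeMoivre unfolding cis_conv_exp .
  qed (auto intro!: continuous_intros)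
  also have "\<dots> = 0"
    using cis_power_int[of "2*pi" "int k"] by (simp flip: Complex.DeMoivre add: cis_2pi)
  finally show ?thesis
    by (subst integral_circle_eq) auto
qed

text \<open>Almost everywhere \<open>w * cnj w = 1\<close>, so for \<open>j \<le> i\<close> the
  integrand collapses to \<open>w ^ (i - j)\<close>. The other case follows by conjugation.\<close>

lemma integral_circle_orthonormal:
  "(LINT w|circle_measure. w ^ i * cnj (w ^ j)) = (if i = j then 1 else 0)"
proof -
  have *: "(LINT w|circle_measure. w ^ i * cnj (w ^ j)) = (if i = j then 1 else 0)" if "j \<le> i" for i j
  proof -
    have "(LINT w|circle_measure. w ^ i * cnj (w ^ j)) = (LINT w|circle_measure. w ^ (i - j))"
    proof (intro integral_cong_AE)
      show "AE w in circle_measure. w ^ i * cnj (w ^ j) = w ^ (i - j)"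
        using AE_circle_norm
      proof eventually_elim
        case (elim w)
        then have "w * cnj w = 1" by (simp add: complex_norm_square[symmetric])
        then have "w ^ j * cnj w ^ j = 1" by (simp flip: power_mult_distrib)
        then show ?case
          using that by (metis complex_cnj_power mult.assoc mult.right_neutral le_add_diff_inverse2 power_add)
      qed
    qed (auto intro!: borel_measurable_continuous_onI continuous_intros)
    also have "\<dots> = (if i = j then 1 else 0)"
      using that integral_circle_power[of "i - j"] circle.prob_space by auto
    finally show ?thesis .
  qed
  show ?thesis
  proof (cases "j \<le> i")
    case False
    have "(LINT w|circle_measure. w ^ i * cnj (w ^ j)) =
        (LINT w|circle_measure. cnj (w ^ j * cnj (w ^ i)))"
      by (simp add: mult.commute)
    also have "\<dots> = cnj (LINT w|circle_measure. w ^ j * cnj (w ^ i))"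
      by (rule Bochner_Integration.integral_cnj)
    finally show ?thesis using *[of i j] False by simp
  qed (use * in simp)
qed

section \<open>Absolutely convergent power series on the circle\<close>

lemma borel_measurable_eval_fps [measurable]:
  "eval_fps (F :: complex fps) \<in> borel_measurable borel"
  unfolding eval_fps_def[abs_def]
  by (intro borel_measurable_suminf borel_measurable_continuous_onI continuous_intros)

lemma norm_eval_fps_le:
  fixes F :: "complex fps"
  assumes "summable (\<lambda>n. norm (F $ n))" "norm w = 1"
  shows "norm (eval_fps F w) \<le> (\<Sum>n. norm (F $ n))"
  using summable_norm[of "\<lambda>n. F $ n * w ^ n"] assms
  by (simp add: eval_fps_def norm_mult norm_power)

text \<open>On the circle the n-th term has norm \<open>norm (F $ n) * norm (G w)\<close>, so the
  integrals of the norms are summable and sum and integral may be exchanged. The lemma serves with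
  \<open>G\<close> a monomial (Fourier coefficients), the series itself (Parseval), and an arbitrary
  square integrable function.\<close>

lemma sums_integral_cnj_eval_fps:
  fixes F :: "complex fps"
  assumes G: "integrable circle_measure G" and F: "summable (\<lambda>n. norm (F $ n))"
  shows "(\<lambda>n. cnj (F $ n) * (LINT w|circle_measure. G w * cnj (w ^ n))) sums
    (LINT w|circle_measure. G w * cnj (eval_fps F w))"
proof -
  have [measurable]: "G \<in> borel_measurable borel"
    using borel_measurable_integrable[OF G] by simp
  let ?f = "\<lambda>n w. cnj (F $ n) * (G w * cnj (w ^ n))"
  have norm_f: "AE w in circle_measure. norm (?f n w) = norm (F $ n) * norm (G w)" for n
    using AE_circle_norm by eventually_elim (simp add: norm_mult norm_power)
  have meas: "?f n \<in> borel_measurable borel" "(\<lambda>w. G w * cnj (w ^ n)) \<in> borel_measurable borel" for n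
    by measurable
  have int_f: "integrable circle_measure (?f n)" for n
    using norm_f[of n]
    by (intro Bochner_Integration.integrable_bound[OF integrable_mult_right[OF integrable_norm[OF G], of "norm (F $ n)"]])
      (auto simp: meas simp del: complex_cnj_power)
  have "(\<lambda>n. integral\<^sup>L circle_measure (?f n)) sums (LINT w|circle_measure. (\<Sum>n. ?f n w))"
  proof (rule sums_integral)
    have "AE w in circle_measure. \<forall>n. norm (?f n w) = norm (F $ n) * norm (G w)"
      using norm_f by (simp add: AE_all_countable)
    then show "AE w in circle_measure. summable (\<lambda>n. norm (?f n w))"
      by eventually_elim (use F in \<open>simp add: summable_mult2\<close>)
    have "(LINT w|circle_measure. norm (?f n w)) = norm (F $ n) * (LINT w|circle_measure. norm (G w))" for n
      by (subst integral_mult_right_zero[symmetric], rule integral_cong_AE)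
        (use meas norm_f in auto)
    then show "summable (\<lambda>n. LINT w|circle_measure. norm (?f n w))"
      using F by (simp add: summable_mult2)
  qed (fact int_f)
  also have "(\<lambda>n. integral\<^sup>L circle_measure (?f n)) =
      (\<lambda>n. cnj (F $ n) * (LINT w|circle_measure. G w * cnj (w ^ n)))"
    by simp
  also have "(LINT w|circle_measure. (\<Sum>n. ?f n w)) = (LINT w|circle_measure. G w * cnj (eval_fps F w))"
  proof (rule integral_cong_AE)
    show "AE w in circle_measure. (\<Sum>n. ?f n w) = G w * cnj (eval_fps F w)"
      using AE_circle_norm
    proof eventually_elim
      case (elim w)
      have "summable (\<lambda>n. F $ n * w ^ n)"
        using F elim by (intro summable_norm_cancel[of "\<lambda>n. F $ n * w ^ n"]) (simp add: norm_mult norm_power)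
      then have "(\<lambda>n. cnj (F $ n * w ^ n)) sums cnj (eval_fps F w)"
        unfolding sums_cnj eval_fps_def by (rule summable_sums)
      then have "(\<lambda>n. G w * cnj (F $ n * w ^ n)) sums (G w * cnj (eval_fps F w))"
        by (rule sums_mult)
      then show ?case by (simp add: sums_iff mult_ac)
    qed
    show "(\<lambda>w. G w * cnj (eval_fps F w)) \<in> borel_measurable circle_measure"
      unfolding borel_measurable_circle_iff
      by measurable
    show "(\<lambda>w. \<Sum>n. ?f n w) \<in> borel_measurable circle_measure"
      using meas by (intro borel_measurable_suminf) simp
  qed
  finally show ?thesis .
qed

lemma integrable_eval_fps:
  fixes F :: "complex fps"
  assumes "summable (\<lambda>n. norm (F $ n))"
  shows "integrable circle_measure (eval_fps F)"
  by (rule integrable_circle_bounded) (use norm_eval_fps_le[OF assms] in auto)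

text \<open>With a monomial in place of \<open>G\<close>, orthonormality leaves a single term of the
  exchanged sum; conjugating gives the coefficient.\<close>

lemma fourier_coeff_eval_fps:
  fixes F :: "complex fps"
  assumes F: "summable (\<lambda>n. norm (F $ n))"
  shows "(LINT w|circle_measure. eval_fps F w * cnj (w ^ k)) = F $ k"
proof -
  have int: "integrable circle_measure (\<lambda>w. w ^ k)"
    by (rule integrable_circle_bounded[where B = 1])
      (auto simp: norm_power intro!: borel_measurable_continuous_onI continuous_intros)
  have "(\<lambda>n. cnj (F $ n) * (LINT w|circle_measure. w ^ k * cnj (w ^ n))) =
      (\<lambda>n. if n = k then cnj (F $ n) else 0)"
    by (auto simp: integral_circle_orthonormal simp del: complex_cnj_power)
  with sums_integral_cnj_eval_fps[OF int F] have "(\<lambda>n. if n = k then cnj (F $ n) else 0) sums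
      (LINT w|circle_measure. w ^ k * cnj (eval_fps F w))"
    by (simp only:)
  then have "cnj (F $ k) = (LINT w|circle_measure. w ^ k * cnj (eval_fps F w))"
    by (intro sums_unique2[OF sums_single[of k "\<lambda>n. cnj (F $ n)"]])
  also have "\<dots> = (LINT w|circle_measure. cnj (eval_fps F w * cnj (w ^ k)))"
    by (simp add: mult.commute)
  finally show ?thesis
    by (simp only: Bochner_Integration.integral_cnj complex_cnj_cancel_iff)
qed

text \<open>The exchange of sum and integral is applied with \<open>G\<close> the series itself,
  whose Fourier coefficients are already known.\<close>

lemma parseval_eval_fps:
  fixes F :: "complex fps"
  assumes F: "summable (\<lambda>n. norm (F $ n))"
  shows "(\<lambda>n. (norm (F $ n))\<^sup>2) sums (LINT w|circle_measure. (norm (eval_fps F w))\<^sup>2)"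
proof -
  have "(\<lambda>n. of_real ((norm (F $ n))\<^sup>2)) sums (LINT w|circle_measure. eval_fps F w * cnj (eval_fps F w))"
    using sums_integral_cnj_eval_fps[OF integrable_eval_fps[OF F] F]
    by (simp only: fourier_coeff_eval_fps[OF F] mult.commute[of "cnj _"] complex_norm_square)
  also have "(LINT w|circle_measure. eval_fps F w * cnj (eval_fps F w)) =
      of_real (LINT w|circle_measure. (norm (eval_fps F w))\<^sup>2)"
    by (simp flip: complex_norm_square integral_complex_of_real add: of_real_power)
  finally show ?thesis
    by (simp only: sums_of_real_iff)
qed

section \<open>Square integrable functions on the circle\<close>

lemma L2_circle_measurable: "f \<in> L2_circle \<Longrightarrow> f \<in> borel_measurable borel"
  by (simp add: L2_circle_def)

lemma L2_circle_integrable: "f \<in> L2_circle \<Longrightarrow> integrable circle_measure (\<lambda>w. (norm (f w))\<^sup>2)"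
  by (simp add: L2_circle_def)

lemma L2_circle_bounded:
  assumes "f \<in> borel_measurable borel" "\<And>w. norm w = 1 \<Longrightarrow> norm (f w) \<le> B"
  shows "f \<in> L2_circle"
  unfolding L2_circle_def
  using assms by (auto intro!: integrable_circle_bounded[where B = "B\<^sup>2"] power_mono)

lemma integrable_norm_mult_L2:
  assumes f: "f \<in> L2_circle" and g: "g \<in> L2_circle"
  shows "integrable circle_measure (\<lambda>w. norm (f w) * norm (g w))"
proof (rule Bochner_Integration.integrable_bound)
  show "integrable circle_measure (\<lambda>w. (norm (f w))\<^sup>2 + (norm (g w))\<^sup>2)"
    using f g by (auto intro: L2_circle_integrable)
  have [measurable]: "f \<in> borel_measurable borel" "g \<in> borel_measurable borel"
    using f g by (auto simp: L2_circle_measurable)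
  show "(\<lambda>w. norm (f w) * norm (g w)) \<in> borel_measurable circle_measure"
    by measurable
  have "x * y \<le> x\<^sup>2 + y\<^sup>2" for x y :: real
    using sum_squares_bound[of x y] zero_le_power2[of x] zero_le_power2[of y]
    by (cases "x * y \<ge> 0") (auto simp: mult.assoc intro: order_trans[of _ 0])
  then show "AE w in circle_measure. norm (norm (f w) * norm (g w)) \<le> norm ((norm (f w))\<^sup>2 + (norm (g w))\<^sup>2)"
    by simp
qed

lemma integrable_mult_cnj_L2:
  assumes f: "f \<in> L2_circle" and g: "g \<in> L2_circle"
  shows "integrable circle_measure (\<lambda>w. f w * cnj (g w))"
proof (rule Bochner_Integration.integrable_bound[OF integrable_norm_mult_L2[OF f g]])
  have [measurable]: "f \<in> borel_measurable borel" "g \<in> borel_measurable borel"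
    using f g by (auto simp: L2_circle_measurable)
  show "(\<lambda>w. f w * cnj (g w)) \<in> borel_measurable circle_measure"
    by measurable
qed (auto simp: norm_mult)

lemma L2_circle_diff:
  assumes f: "f \<in> L2_circle" and g: "g \<in> L2_circle"
  shows "(\<lambda>w. f w - g w) \<in> L2_circle"
proof -
  have [measurable]: "f \<in> borel_measurable borel" "g \<in> borel_measurable borel"
    using f g by (auto simp: L2_circle_measurable)
  have "integrable circle_measure (\<lambda>w. (norm (f w - g w))\<^sup>2)"
  proof (rule Bochner_Integration.integrable_bound)
    show "integrable circle_measure (\<lambda>w. 2 * (norm (f w))\<^sup>2 + 2 * (norm (g w))\<^sup>2)"
      using f g by (intro Bochner_Integration.integrable_add integrable_mult_right L2_circle_integrable)
    show "(\<lambda>w. (norm (f w - g w))\<^sup>2) \<in> borel_measurable circle_measure"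
      by measurable
    have "(norm (x - y))\<^sup>2 \<le> 2 * (norm x)\<^sup>2 + 2 * (norm y)\<^sup>2" for x y :: complex
    proof -
      have "(norm (x - y))\<^sup>2 \<le> (norm x + norm y)\<^sup>2"
        by (intro power_mono norm_triangle_ineq4) auto
      also have "\<dots> \<le> 2 * (norm x)\<^sup>2 + 2 * (norm y)\<^sup>2"
        using sum_squares_bound[of "norm x" "norm y"] by (simp add: power2_sum)
      finally show ?thesis .
    qed
    then show "AE w in circle_measure. norm ((norm (f w - g w))\<^sup>2) \<le> norm (2 * (norm (f w))\<^sup>2 + 2 * (norm (g w))\<^sup>2)"
      by simp
  qed
  then show ?thesis by (simp add: L2_circle_def)
qed

lemma L2_circle_mult_bounded:
  assumes f: "f \<in> L2_circle" and g: "g \<in> borel_measurable borel" "\<And>w. norm w = 1 \<Longrightarrow> norm (g w) \<le> B"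
  shows "(\<lambda>w. g w * f w) \<in> L2_circle"
proof -
  have [measurable]: "f \<in> borel_measurable borel" "g \<in> borel_measurable borel"
    using f g by (auto simp: L2_circle_measurable)
  have "integrable circle_measure (\<lambda>w. (norm (g w * f w))\<^sup>2)"
  proof (rule Bochner_Integration.integrable_bound)
    show "integrable circle_measure (\<lambda>w. B\<^sup>2 * (norm (f w))\<^sup>2)"
      using f by (auto intro: L2_circle_integrable)
    show "(\<lambda>w. (norm (g w * f w))\<^sup>2) \<in> borel_measurable circle_measure"
      by measurable
    show "AE w in circle_measure. norm ((norm (g w * f w))\<^sup>2) \<le> norm (B\<^sup>2 * (norm (f w))\<^sup>2)"
      using AE_circle_norm
      by eventually_elim (auto simp: norm_mult power_mult_distrib intro!: mult_right_mono power_mono g)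
  qed
  then show ?thesis by (simp add: L2_circle_def)
qed

text \<open>The quadratic in \<open>t\<close> that arises from integrating
  \<open>(norm (f w) - t * norm (g w))\<^sup>2\<close> is nonnegative. It is evaluated at its vertex
  \<open>?c / ?b\<close>, or at a suitable point when it degenerates to a linear function.\<close>

lemma L2_Cauchy_Schwarz_norm:
  assumes f: "f \<in> L2_circle" and g: "g \<in> L2_circle"
  shows "(LINT w|circle_measure. norm (f w) * norm (g w))\<^sup>2 \<le>
    (LINT w|circle_measure. (norm (f w))\<^sup>2) * (LINT w|circle_measure. (norm (g w))\<^sup>2)"
    (is "?c\<^sup>2 \<le> ?a * ?b")
proof -
  note int = L2_circle_integrable[OF f] L2_circle_integrable[OF g] integrable_norm_mult_L2[OF f g]
  have quad: "0 \<le> ?a - 2 * t * ?c + t\<^sup>2 * ?b" for t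
  proof -
    have "0 \<le> (LINT w|circle_measure. (norm (f w) - t * norm (g w))\<^sup>2)"
      by simp
    also have "\<dots> = (LINT w|circle_measure. (norm (f w))\<^sup>2 - (2 * t) * (norm (f w) * norm (g w)) + t\<^sup>2 * (norm (g w))\<^sup>2)"
      by (simp add: power2_eq_square algebra_simps)
    also have "\<dots> = ?a - 2 * t * ?c + t\<^sup>2 * ?b"
      using int by (simp add: Bochner_Integration.integral_add Bochner_Integration.integral_diff)
    finally show ?thesis .
  qed
  have aux: "c\<^sup>2 \<le> a * b" if "b > 0" "0 \<le> a - 2 * (c / b) * c + (c / b)\<^sup>2 * b" for a b c :: real
    using that by (simp add: power2_eq_square field_simps)
  have "0 \<le> ?b" by simp
  show ?thesis
  proof (cases "?b = 0")
    case True
    have "?c = 0"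
    proof (rule ccontr)
      assume "?c \<noteq> 0"
      \<comment> \<open>For \<open>?b = 0\<close> this choice of \<open>t\<close> gives the linear
        function the value \<open>?a - (?a + 1) = -1\<close>.\<close>
      then show False
        using quad[of "(?a + 1) / (2 * ?c)"] True by (simp add: field_simps)
    qed
    then show ?thesis by simp
  next
    case False
    then show ?thesis
      using \<open>0 \<le> ?b\<close> by (intro aux quad) linarith
  qed
qed

lemma L2_Cauchy_Schwarz:
  assumes f: "f \<in> L2_circle" and g: "g \<in> L2_circle"
  shows "(norm (L2_inner f g))\<^sup>2 \<le>
    (LINT w|circle_measure. (norm (f w))\<^sup>2) * (LINT w|circle_measure. (norm (g w))\<^sup>2)"
proof -
  have "norm (L2_inner f g) \<le> (LINT w|circle_measure. norm (f w) * norm (g w))"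
    unfolding L2_inner_def using integral_norm_bound[of circle_measure "\<lambda>w. f w * cnj (g w)"]
    by (simp add: norm_mult)
  then have "(norm (L2_inner f g))\<^sup>2 \<le> (LINT w|circle_measure. norm (f w) * norm (g w))\<^sup>2"
    by (rule power_mono) simp
  with L2_Cauchy_Schwarz_norm[OF f g] show ?thesis by linarith
qed

lemma L2_inner_commute: "L2_inner f g = cnj (L2_inner g f)"
  unfolding L2_inner_def
  by (subst Bochner_Integration.integral_cnj[symmetric]) (simp add: mult.commute)

lemma L2_inner_diff_left:
  assumes "f \<in> L2_circle" "g \<in> L2_circle" "h \<in> L2_circle"
  shows "L2_inner (\<lambda>w. f w - g w) h = L2_inner f h - L2_inner g h"
  using integrable_mult_cnj_L2[OF assms(1,3)] integrable_mult_cnj_L2[OF assms(2,3)]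
  by (simp add: L2_inner_def left_diff_distrib)

text \<open>By Cauchy-Schwarz the error is at most the square root of the squared distance times the
  squared norm of \<open>h\<close>. Membership of \<open>f x\<close> is asked for only eventually,
  to fit dilates with radius tending to 1 from the left.\<close>

lemma tendsto_L2_inner:
  assumes lim: "((\<lambda>x. LINT w|circle_measure. (norm (f x w - g w))\<^sup>2) \<longlongrightarrow> 0) F"
    and f: "\<forall>\<^sub>F x in F. f x \<in> L2_circle" and g: "g \<in> L2_circle" and h: "h \<in> L2_circle"
  shows "((\<lambda>x. L2_inner (f x) h) \<longlongrightarrow> L2_inner g h) F"
proof -
  let ?b = "LINT w|circle_measure. (norm (h w))\<^sup>2"
  let ?d = "\<lambda>x. LINT w|circle_measure. (norm (f x w - g w))\<^sup>2"
  have "((\<lambda>x. L2_inner (f x) h - L2_inner g h) \<longlongrightarrow> 0) F"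
  proof (rule Lim_null_comparison)
    show "\<forall>\<^sub>F x in F. norm (L2_inner (f x) h - L2_inner g h) \<le> sqrt (?d x * ?b)"
      using f
    proof eventually_elim
      case (elim x)
      show ?case
        using L2_Cauchy_Schwarz[OF L2_circle_diff[OF elim g] h]
        by (simp add: L2_inner_diff_left[OF elim g h] real_le_rsqrt)
    qed
    show "((\<lambda>x. sqrt (?d x * ?b)) \<longlongrightarrow> 0) F"
      using tendsto_real_sqrt[OF tendsto_mult_left_zero[OF lim, of ?b]] by simp
  qed
  then show ?thesis by (simp add: LIM_zero_iff)
qed

section \<open>Boundary functions\<close>

lemma L2_circle_const: "(\<lambda>_. c) \<in> L2_circle"
  by (rule L2_circle_bounded[of _ "norm c"]) auto

text \<open>This is the core of the Riesz-Fischer argument. On a probability space the mean of the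
  norm is at most the quadratic mean, so the increments have integrals bounded by a geometric
  series; hence the sum of their norms is finite almost everywhere.\<close>

lemma L2_fast_Cauchy_converges_AE:
  assumes u: "\<And>k. u k \<in> L2_circle"
    and fast: "\<And>k. (LINT w|circle_measure. (norm (u (Suc k) w - u k w))\<^sup>2) \<le> ((1/2) ^ k)\<^sup>2"
  shows "AE w in circle_measure. convergent (\<lambda>k. u k w)"
proof -
  let ?d = "\<lambda>k w. u (Suc k) w - u k w"
  have L2: "?d k \<in> L2_circle" for k
    by (intro L2_circle_diff u)
  have [measurable]: "u k \<in> borel_measurable borel" for k
    by (rule L2_circle_measurable[OF u])
  have int: "integrable circle_measure (\<lambda>w. norm (?d k w))" for k
    using integrable_norm_mult_L2[OF L2[of k] L2_circle_const[of 1]] by simp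
  have le: "(LINT w|circle_measure. norm (?d k w)) \<le> (1/2) ^ k" for k
  proof (rule power2_le_imp_le)
    have "(LINT w|circle_measure. norm (?d k w))\<^sup>2 \<le> (LINT w|circle_measure. (norm (?d k w))\<^sup>2)"
      using L2_Cauchy_Schwarz_norm[OF L2[of k] L2_circle_const[of 1]] circle.prob_space by simp
    with fast[of k] show "(LINT w|circle_measure. norm (?d k w))\<^sup>2 \<le> ((1/2) ^ k)\<^sup>2"
      by linarith
  qed simp
  have "(\<integral>\<^sup>+w. (\<Sum>k. ennreal (norm (?d k w))) \<partial>circle_measure) =
      (\<Sum>k. \<integral>\<^sup>+w. ennreal (norm (?d k w)) \<partial>circle_measure)"
    by (rule nn_integral_suminf) measurable
  also have "\<dots> = (\<Sum>k. ennreal (LINT w|circle_measure. norm (?d k w)))"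
    using int by (simp add: nn_integral_eq_integral)
  also have "\<dots> \<le> (\<Sum>k. ennreal ((1/2) ^ k))"
    by (intro suminf_le ennreal_leI le) auto
  also have "\<dots> < \<infinity>"
    by (subst suminf_ennreal_eq[OF _ geometric_sums[of "1/2::real"]]) auto
  finally have "AE w in circle_measure. (\<Sum>k. ennreal (norm (?d k w))) \<noteq> \<infinity>"
    by (intro nn_integral_PInf_AE) auto
  then show ?thesis
  proof eventually_elim
    case (elim w)
    then have "summable (\<lambda>k. norm (?d k w))"
      by (intro summable_suminf_not_top) auto
    then have "summable (\<lambda>k. ?d k w)"
      by (rule summable_norm_cancel)
    then have "convergent (\<lambda>n. \<Sum>k<n. ?d k w)"
      by (simp add: summable_iff_convergent)
    then have "convergent (\<lambda>n. u n w - u 0 w)"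
      by (simp add: sum_lessThan_telescope[of "\<lambda>k. u k w"])
    then show "convergent (\<lambda>k. u k w)"
      using convergent_diff[of "\<lambda>n. u n w - u 0 w" "\<lambda>_. - u 0 w"] by (simp add: convergent_const)
  qed
qed

text \<open>Fatou's lemma is applied to \<open>(norm (f w - u k w))\<^sup>2\<close>. Membership of
  \<open>g\<close> follows by writing it as \<open>f - (f - g)\<close>. In the application
  \<open>f\<close> is one fixed dilate and \<open>u\<close> a sequence of dilates tending to the
  boundary function.\<close>

lemma L2_Fatou:
  assumes f: "f \<in> L2_circle" and u: "\<And>k. u k \<in> L2_circle" and g: "g \<in> borel_measurable borel"
    and lim: "AE w in circle_measure. (\<lambda>k. u k w) \<longlonglongrightarrow> g w"
    and le: "\<And>k. (LINT w|circle_measure. (norm (f w - u k w))\<^sup>2) \<le> e k" and e: "e \<longlonglongrightarrow> E"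
  shows "g \<in> L2_circle" "(LINT w|circle_measure. (norm (f w - g w))\<^sup>2) \<le> E"
proof -
  have [measurable]: "f \<in> borel_measurable borel" "u k \<in> borel_measurable borel" for k
    using f u by (auto simp: L2_circle_measurable)
  note [measurable] = g
  have "E \<ge> 0"
    by (intro LIMSEQ_le_const[OF e] exI allI impI order_trans[OF _ le]) simp
  have "(\<integral>\<^sup>+w. ennreal ((norm (f w - g w))\<^sup>2) \<partial>circle_measure) =
      (\<integral>\<^sup>+w. liminf (\<lambda>k. ennreal ((norm (f w - u k w))\<^sup>2)) \<partial>circle_measure)"
  proof (rule nn_integral_cong_AE)
    show "AE w in circle_measure. ennreal ((norm (f w - g w))\<^sup>2) = liminf (\<lambda>k. ennreal ((norm (f w - u k w))\<^sup>2))"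
      using lim
      by eventually_elim (rule sym, intro lim_imp_Liminf tendsto_intros; simp)
  qed
  also have "\<dots> \<le> liminf (\<lambda>k. \<integral>\<^sup>+w. ennreal ((norm (f w - u k w))\<^sup>2) \<partial>circle_measure)"
    by (rule nn_integral_liminf) measurable
  also have "\<dots> = liminf (\<lambda>k. ennreal (LINT w|circle_measure. (norm (f w - u k w))\<^sup>2))"
    by (intro arg_cong[where f = liminf] ext nn_integral_eq_integral L2_circle_integrable
        L2_circle_diff f u) auto
  also have "\<dots> \<le> liminf (\<lambda>k. ennreal (e k))"
    by (intro Liminf_mono always_eventually allI ennreal_leI le)
  also have "\<dots> = ennreal E"
    by (intro lim_imp_Liminf tendsto_ennrealI e) simp
  finally have fin: "(\<integral>\<^sup>+w. ennreal ((norm (f w - g w))\<^sup>2) \<partial>circle_measure) \<le> ennreal E" .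
  then have int: "integrable circle_measure (\<lambda>w. (norm (f w - g w))\<^sup>2)"
    by (intro integrableI_nonneg) (auto simp: le_less_trans)
  then have "ennreal (LINT w|circle_measure. (norm (f w - g w))\<^sup>2) \<le> ennreal E"
    using fin by (subst (asm) nn_integral_eq_integral) auto
  then show "(LINT w|circle_measure. (norm (f w - g w))\<^sup>2) \<le> E"
    using \<open>E \<ge> 0\<close> by (simp add: ennreal_le_iff)
  have "(\<lambda>w. f w - g w) \<in> L2_circle"
    using int by (simp add: L2_circle_def)
  from L2_circle_diff[OF f this] show "g \<in> L2_circle"
    by simp
qed

section \<open>Square summable power series and their dilates\<close>

definition sq_summable :: "complex fps \<Rightarrow> bool" where
  "sq_summable F \<longleftrightarrow> summable (\<lambda>n. (norm (F $ n))\<^sup>2)"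

text \<open>Extension by zero is the form that \<open>H2\<close> demands; with it, equality of
  functions on the plane amounts to equality of coefficients.\<close>

definition hardy :: "complex fps \<Rightarrow> complex \<Rightarrow> complex" where
  "hardy F z = (if norm z < 1 then eval_fps F z else 0)"

lemma borel_measurable_hardy [measurable]: "hardy F \<in> borel_measurable borel"
  unfolding hardy_def[abs_def] by measurable

definition dilate :: "real \<Rightarrow> complex fps \<Rightarrow> complex fps" where
  "dilate r F = Abs_fps (\<lambda>n. of_real r ^ n * F $ n)"

lemma dilate_nth [simp]: "dilate r F $ n = of_real r ^ n * F $ n"
  by (simp add: dilate_def)

lemma eval_fps_dilate: "eval_fps (dilate r F) z = eval_fps F (of_real r * z)"
  by (simp add: eval_fps_def power_mult_distrib mult_ac)

lemma hardy_dilate: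
  assumes "0 \<le> r" "r < 1" "norm w = 1"
  shows "hardy F (of_real r * w) = eval_fps (dilate r F) w"
  using assms by (simp add: hardy_def eval_fps_dilate norm_mult)

lemma sq_summable_imp_bounded:
  fixes F :: "complex fps"
  assumes "sq_summable F"
  obtains B where "\<And>n. norm (F $ n) \<le> B"
proof -
  have "(\<lambda>n. (norm (F $ n))\<^sup>2) \<longlonglongrightarrow> 0"
    using assms unfolding sq_summable_def by (rule summable_LIMSEQ_zero)
  then have "Bseq (\<lambda>n. (norm (F $ n))\<^sup>2)"
    by (intro convergent_imp_Bseq) (unfold convergent_def, rule exI)
  then obtain K where K: "K > 0" "\<And>n. (norm (F $ n))\<^sup>2 \<le> K"
    by (auto simp: Bseq_def)
  then have "norm (F $ n) \<le> sqrt K" for n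
    by (simp add: real_le_rsqrt)
  then show ?thesis by (rule that)
qed

lemma sq_summable_imp_summable_power:
  assumes "sq_summable F" "norm z < 1"
  shows "summable (\<lambda>n. norm (F $ n * z ^ n))"
proof -
  obtain B where B: "\<And>n. norm (F $ n) \<le> B"
    using sq_summable_imp_bounded assms(1) by metis
  show ?thesis
  proof (rule summable_comparison_test')
    show "summable (\<lambda>n. B * norm z ^ n)"
      using assms(2) by (intro summable_mult summable_geometric) auto
    show "norm (norm (F $ n * z ^ n)) \<le> B * norm z ^ n" for n
      using B[of n] by (simp add: norm_mult norm_power mult_right_mono)
  qed
qed

lemma sq_summable_imp_conv_radius:
  assumes "sq_summable F"
  shows "fps_conv_radius F \<ge> 1"
  unfolding fps_conv_radius_def
proof (rule conv_radius_geI_ex')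
  fix r :: real assume "0 < r" "ereal r < 1"
  then show "summable (\<lambda>n. F $ n * of_real r ^ n)"
    using assms by (intro summable_norm_cancel[OF sq_summable_imp_summable_power]) auto
qed

lemma summable_norm_dilate:
  assumes "sq_summable F" "0 \<le> r" "r < 1"
  shows "summable (\<lambda>n. norm (dilate r F $ n))"
  using sq_summable_imp_summable_power[OF assms(1), of "of_real r"] assms by (simp add: mult.commute)

lemma eval_fps_L2_circle:
  fixes F :: "complex fps"
  assumes "summable (\<lambda>n. norm (F $ n))"
  shows "eval_fps F \<in> L2_circle"
  by (rule L2_circle_bounded) (use norm_eval_fps_le[OF assms] in auto)

text \<open>Parseval for the difference of two dilates, whose coefficients are
  \<open>r ^ n - s ^ n\<close> times those of \<open>F\<close>. Both series converge absolutely on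
  the circle, so evaluation respects the difference there.\<close>

lemma dist_dilate_sums:
  assumes F: "sq_summable F" and r: "0 \<le> r" "r < 1" and s: "0 \<le> s" "s < 1"
  shows "(\<lambda>n. (r ^ n - s ^ n)\<^sup>2 * (norm (F $ n))\<^sup>2) sums
    (LINT w|circle_measure. (norm (eval_fps (dilate r F) w - eval_fps (dilate s F) w))\<^sup>2)"
proof -
  note sum = summable_norm_dilate[OF F r] summable_norm_dilate[OF F s]
  let ?D = "dilate r F - dilate s F"
  have D: "summable (\<lambda>n. norm (?D $ n))"
    by (rule summable_comparison_test'[OF summable_add[OF sum]])
      (simp add: norm_triangle_ineq4 del: dilate_nth)
  have "norm (?D $ n) = \<bar>r ^ n - s ^ n\<bar> * norm (F $ n)" for n
  proof -
    have "?D $ n = of_real (r ^ n - s ^ n) * F $ n"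
      by (simp add: left_diff_distrib)
    then show ?thesis
      by (simp only: norm_mult norm_of_real)
  qed
  then have "(\<lambda>n. (r ^ n - s ^ n)\<^sup>2 * (norm (F $ n))\<^sup>2) sums (LINT w|circle_measure. (norm (eval_fps ?D w))\<^sup>2)"
    using parseval_eval_fps[OF D] by (simp add: power_mult_distrib)
  also have "(LINT w|circle_measure. (norm (eval_fps ?D w))\<^sup>2) =
      (LINT w|circle_measure. (norm (eval_fps (dilate r F) w - eval_fps (dilate s F) w))\<^sup>2)"
  proof (intro integral_cong_AE)
    show "AE w in circle_measure. (norm (eval_fps ?D w))\<^sup>2 =
        (norm (eval_fps (dilate r F) w - eval_fps (dilate s F) w))\<^sup>2"
      using AE_circle_norm
    proof eventually_elim
      case (elim w)
      have "summable (\<lambda>n. dilate t F $ n * w ^ n)" if "summable (\<lambda>n. norm (dilate t F $ n))" for t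
        using that elim by (intro summable_norm_cancel[of "\<lambda>n. dilate t F $ n * w ^ n"])
          (simp add: norm_mult norm_power del: dilate_nth)
      then have "eval_fps ?D w = eval_fps (dilate r F) w - eval_fps (dilate s F) w"
        using sum unfolding eval_fps_def
        by (subst suminf_diff) (simp_all add: left_diff_distrib del: dilate_nth)
      then show ?case by simp
    qed
  qed measurable
  finally show ?thesis .
qed

lemma sq_summable_dilation_error:
  assumes "sq_summable F" "0 \<le> r" "r \<le> 1"
  shows "summable (\<lambda>n. (1 - r ^ n)\<^sup>2 * (norm (F $ n))\<^sup>2)"
proof (rule summable_comparison_test')
  show "summable (\<lambda>n. (norm (F $ n))\<^sup>2)" using assms by (simp add: sq_summable_def)
  have "(1 - r ^ n)\<^sup>2 \<le> 1" for n
    using assms power_le_one[of r n] by (intro power_le_one) auto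
  then show "norm ((1 - r ^ n)\<^sup>2 * (norm (F $ n))\<^sup>2) \<le> (norm (F $ n))\<^sup>2" for n
    by (simp add: mult_left_le_one_le)
qed

text \<open>This is the squared distance between the dilate by \<open>r\<close> and the boundary
  function, written in coefficients so that it is available before a boundary function has been
  constructed.\<close>

definition dilation_error :: "complex fps \<Rightarrow> real \<Rightarrow> real" where
  "dilation_error F r = (\<Sum>n. (1 - r ^ n)\<^sup>2 * (norm (F $ n))\<^sup>2)"

lemma dilation_error_nonneg:
  assumes "sq_summable F" "0 \<le> r" "r \<le> 1"
  shows "dilation_error F r \<ge> 0"
  unfolding dilation_error_def by (rule suminf_nonneg[OF sq_summable_dilation_error[OF assms]]) auto

text \<open>Dominated convergence for series (Tannery's theorem): each term tends to 0, and
  \<open>(norm (F $ n))\<^sup>2\<close> is a summable majorant for all radii in the unit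
  interval.\<close>

lemma dilation_error_tendsto_0:
  assumes F: "sq_summable F"
  shows "(dilation_error F \<longlongrightarrow> 0) (at_left 1)"
proof -
  have "((\<lambda>r. \<Sum>n. (1 - r ^ n)\<^sup>2 * (norm (F $ n))\<^sup>2) \<longlongrightarrow> (\<Sum>n. 0)) (at_left (1::real))"
  proof (intro tannerys_theorem[THEN conjunct2, THEN conjunct2])
    show "((\<lambda>r. (1 - r ^ n)\<^sup>2 * (norm (F $ n))\<^sup>2) \<longlongrightarrow> 0) (at_left (1::real))" for n
      by (auto intro!: tendsto_eq_intros)
    have "\<forall>\<^sub>F r in at_left 1. 0 < r \<and> r < (1::real)"
      using eventually_at_left_real[of 0 1] by simp
    then have "\<forall>\<^sub>F p in (at_top :: nat filter) \<times>\<^sub>F at_left (1::real). 0 < snd p \<and> snd p < 1"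
      using eventually_prod2[of "at_top :: nat filter" "\<lambda>r. 0 < r \<and> r < (1::real)"]
      by (simp add: case_prod_unfold)
    then show "\<forall>\<^sub>F (n, r) in at_top \<times>\<^sub>F at_left (1::real).
        norm ((1 - r ^ n)\<^sup>2 * (norm (F $ n))\<^sup>2) \<le> (norm (F $ n))\<^sup>2"
    proof eventually_elim
      case (elim p)
      then have "(1 - snd p ^ fst p)\<^sup>2 \<le> 1"
        using power_le_one[of "snd p" "fst p"] by (intro power_le_one) auto
      then show ?case
        by (simp add: case_prod_unfold mult_left_le_one_le)
    qed
  qed (use F in \<open>auto simp: sq_summable_def\<close>)
  then show ?thesis by (simp add: dilation_error_def[abs_def])
qed

text \<open>If \<open>r \<le> s\<close>, then \<open>r ^ n \<le> s ^ n \<le> 1\<close>, so the gap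
  between the two powers is at most \<open>1 - r ^ n\<close>; the other order is symmetric. This is
  the Cauchy property of the dilates.\<close>

lemma dist_dilate_le:
  assumes F: "sq_summable F" and r: "0 \<le> r" "r < 1" and s: "0 \<le> s" "s < 1"
  shows "(LINT w|circle_measure. (norm (eval_fps (dilate r F) w - eval_fps (dilate s F) w))\<^sup>2) \<le>
    dilation_error F r + dilation_error F s"
proof (rule sums_le)
  have *: "(r ^ n - s ^ n)\<^sup>2 \<le> (1 - r ^ n)\<^sup>2" if "r \<le> s" "0 \<le> r" "s < 1" for r s :: real and n
    unfolding power2_commute[of "r ^ n"]
    using that power_le_one[of s n] power_mono[of r s n] by (intro power_mono) auto
  have "(r ^ n - s ^ n)\<^sup>2 \<le> (1 - r ^ n)\<^sup>2 + (1 - s ^ n)\<^sup>2" for n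
    using *[of r s n] *[of s r n] r s
    by (cases "r \<le> s") (auto simp: power2_commute[of "s ^ n"] intro: order_trans)
  then show "(r ^ n - s ^ n)\<^sup>2 * (norm (F $ n))\<^sup>2 \<le>
      (1 - r ^ n)\<^sup>2 * (norm (F $ n))\<^sup>2 + (1 - s ^ n)\<^sup>2 * (norm (F $ n))\<^sup>2" for n
    by (metis distrib_right mult_right_mono zero_le_power2)
  show "(\<lambda>n. (1 - r ^ n)\<^sup>2 * (norm (F $ n))\<^sup>2 + (1 - s ^ n)\<^sup>2 * (norm (F $ n))\<^sup>2) sums
      (dilation_error F r + dilation_error F s)"
    unfolding dilation_error_def
    using r s by (intro sums_add summable_sums sq_summable_dilation_error F) auto
qed (rule dist_dilate_sums[OF assms])

text \<open>A sequence of dilates with rapidly decreasing errors converges almost everywhere.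
  Fatou's lemma then bounds the distance of every dilate from the limit by its dilation error, so
  convergence holds for all radii tending to 1 and not only along the chosen sequence.\<close>

lemma ex_is_boundary_function:
  assumes F: "sq_summable F"
  shows "\<exists>g. is_boundary_function (hardy F) g"
proof -
  have ex_r: "\<exists>r. 0 < r \<and> r < 1 \<and> dilation_error F r < e" if "e > 0" for e
  proof -
    have "\<forall>\<^sub>F r in at_left 1. dilation_error F r < e \<and> 0 < r \<and> r < 1"
      using eventually_at_left_real[of 0 1] order_tendstoD(2)[OF dilation_error_tendsto_0[OF F] that]
      by (auto elim: eventually_elim2)
    then show ?thesis
      using eventually_happens'[of "at_left (1::real)"] by fastforce
  qed
  \<comment> \<open>The factor \<open>1 / 2\<close> lets the errors of two consecutive dilates add
    up to at most \<open>((1/2) ^ k)\<^sup>2\<close>.\<close>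
  have "\<exists>r. \<forall>k. 0 < r k \<and> r k < 1 \<and> dilation_error F (r k) < ((1/2) ^ k)\<^sup>2 / 2"
    by (intro choice allI ex_r) simp
  then obtain r where r: "\<And>k. 0 < r k" "\<And>k. r k < 1"
    and err: "\<And>k. dilation_error F (r k) < ((1/2) ^ k)\<^sup>2 / 2"
    by metis
  define u where "u k = eval_fps (dilate (r k) F)" for k
  have u: "u k \<in> L2_circle" for k
    unfolding u_def using r by (intro eval_fps_L2_circle summable_norm_dilate F less_imp_le) auto
  have [measurable]: "u k \<in> borel_measurable borel" for k
    by (rule L2_circle_measurable[OF u])
  have "(LINT w|circle_measure. (norm (u (Suc k) w - u k w))\<^sup>2) \<le> ((1/2) ^ k)\<^sup>2" for k
  proof -
    have "((1/2) ^ Suc k)\<^sup>2 \<le> ((1/2::real) ^ k)\<^sup>2"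
      by (intro power_mono) auto
    with err[of k] err[of "Suc k"] dist_dilate_le[OF F, of "r (Suc k)" "r k"] r[of k] r[of "Suc k"]
    show ?thesis unfolding u_def by linarith
  qed
  from L2_fast_Cauchy_converges_AE[OF u this]
  have conv: "AE w in circle_measure. convergent (\<lambda>k. u k w)" .
  \<comment> \<open>\<open>lim\<close> yields a measurable function on the whole plane, whatever its
    values on the null set of divergence.\<close>
  define g where "g w = lim (\<lambda>k. u k w)" for w
  have g [measurable]: "g \<in> borel_measurable borel"
    unfolding g_def[abs_def] by measurable
  have lim: "AE w in circle_measure. (\<lambda>k. u k w) \<longlonglongrightarrow> g w"
    using conv by eventually_elim (simp add: g_def convergent_LIMSEQ_iff)
  have err_lim: "(\<lambda>k. dilation_error F t + dilation_error F (r k)) \<longlonglongrightarrow> dilation_error F t" for t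
  proof -
    have "(\<lambda>k. dilation_error F (r k)) \<longlonglongrightarrow> 0"
    proof (rule tendsto_sandwich[OF _ _ tendsto_const])
      show "(\<lambda>k. ((1/2::real) ^ k)\<^sup>2 / 2) \<longlonglongrightarrow> 0"
        by (auto intro!: tendsto_eq_intros LIMSEQ_power_zero)
      show "\<forall>\<^sub>F k in sequentially. dilation_error F (r k) \<le> ((1/2) ^ k)\<^sup>2 / 2"
        using err by (intro always_eventually allI less_imp_le)
      show "\<forall>\<^sub>F k in sequentially. 0 \<le> dilation_error F (r k)"
        using r by (intro always_eventually allI dilation_error_nonneg F less_imp_le)
    qed
    from tendsto_add[OF tendsto_const[of "dilation_error F t"] this] show ?thesis by simp
  qed
  have bound: "g \<in> L2_circle"
    "(LINT w|circle_measure. (norm (eval_fps (dilate t F) w - g w))\<^sup>2) \<le> dilation_error F t"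
    if "0 \<le> t" "t < 1" for t
    using L2_Fatou[OF eval_fps_L2_circle[OF summable_norm_dilate[OF F that]] u g lim _ err_lim[of t]]
      dist_dilate_le[OF F that] r unfolding u_def by (auto simp: less_imp_le)
  have "((\<lambda>t. LINT w|circle_measure. (norm (hardy F (of_real t * w) - g w))\<^sup>2) \<longlongrightarrow> 0) (at_left 1)"
  proof (rule tendsto_sandwich[OF _ _ tendsto_const dilation_error_tendsto_0[OF F]])
    show "\<forall>\<^sub>F t in at_left 1. (LINT w|circle_measure. (norm (hardy F (of_real t * w) - g w))\<^sup>2) \<le> dilation_error F t"
      using eventually_at_left_real[of 0 "1::real"]
    proof (rule eventually_mono)
      fix t :: real assume t: "t \<in> {0<..<1}"
      have "(LINT w|circle_measure. (norm (hardy F (of_real t * w) - g w))\<^sup>2) =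
          (LINT w|circle_measure. (norm (eval_fps (dilate t F) w - g w))\<^sup>2)"
      proof (rule integral_cong_AE)
        show "AE w in circle_measure. (norm (hardy F (of_real t * w) - g w))\<^sup>2 =
            (norm (eval_fps (dilate t F) w - g w))\<^sup>2"
          using AE_circle_norm by eventually_elim (use t in \<open>simp add: hardy_dilate\<close>)
      qed measurable
      then show "(LINT w|circle_measure. (norm (hardy F (of_real t * w) - g w))\<^sup>2) \<le> dilation_error F t"
        using bound t by simp
    qed simp
  qed simp
  \<comment> \<open>The radius 0 merely serves to extract \<open>g \<in> L2_circle\<close>, a
    conclusion in which \<open>t\<close> does not occur.\<close>
  with bound[of 0] show ?thesis
    unfolding is_boundary_function_def by auto
qed

section \<open>The Hardy space as a sequence space\<close>

lemma eventually_at_left_1: "\<forall>\<^sub>F r in at_left (1::real). 0 < r \<and> r < 1"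
  using eventually_at_left_real[of 0 1] by simp

text \<open>The hypothesis concerns a single dilate, because \<open>H2_eq\<close> applies the lemma
  to Taylor coefficients whose square summability is still to be shown.\<close>

lemma integral_norm_hardy_sums:
  assumes F: "summable (\<lambda>n. norm (dilate r F $ n))" and r: "0 \<le> r" "r < 1"
  shows "(\<lambda>n. (r ^ n * norm (F $ n))\<^sup>2) sums (LINT w|circle_measure. (norm (hardy F (of_real r * w)))\<^sup>2)"
proof -
  have "(LINT w|circle_measure. (norm (hardy F (of_real r * w)))\<^sup>2) =
      (LINT w|circle_measure. (norm (eval_fps (dilate r F) w))\<^sup>2)"
  proof (rule integral_cong_AE)
    show "AE w in circle_measure. (norm (hardy F (of_real r * w)))\<^sup>2 = (norm (eval_fps (dilate r F) w))\<^sup>2"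
      using AE_circle_norm by eventually_elim (use r in \<open>simp add: hardy_dilate\<close>)
  qed measurable
  then show ?thesis
    using parseval_eval_fps[OF F] r by (simp add: norm_mult norm_power)
qed

lemma hardy_in_H2:
  assumes F: "sq_summable F"
  shows "hardy F \<in> H2"
  unfolding H2_def
proof (intro CollectI conjI allI impI)
  have "eval_fps F holomorphic_on ball 0 1"
    using eball_mono[OF sq_summable_imp_conv_radius[OF F], of 0]
    by (intro holomorphic_on_eval_fps) (simp add: one_ereal_def)
  then show "hardy F holomorphic_on ball 0 1"
    by (rule holomorphic_transform) (auto simp: hardy_def)
  show "hardy F z = 0" if "z \<notin> ball 0 1" for z
    using that by (simp add: hardy_def)
  show "bdd_above ((\<lambda>r. LINT w|circle_measure. (norm (hardy F (of_real r * w)))\<^sup>2) ` {0..<1})"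
  proof (rule bdd_aboveI2)
    fix r :: real assume r: "r \<in> {0..<1}"
    have "(r ^ n * norm (F $ n))\<^sup>2 \<le> (norm (F $ n))\<^sup>2" for n
      using r by (intro power_mono mult_left_le_one_le) (auto intro: power_le_one)
    then show "(LINT w|circle_measure. (norm (hardy F (of_real r * w)))\<^sup>2) \<le> (\<Sum>n. (norm (F $ n))\<^sup>2)"
      using F r by (intro sums_le[OF _ integral_norm_hardy_sums summable_sums] summable_norm_dilate)
        (auto simp: sq_summable_def)
  qed
qed

text \<open>For the nontrivial inclusion take the Taylor coefficients at 0. A partial sum of their
  squares, weighted by powers of \<open>r\<close>, is at most the integral mean at radius
  \<open>r\<close> and hence at most \<open>B\<close>; in a finite sum \<open>r\<close> may tend to
  1.\<close>

lemma H2_eq: "H2 = hardy ` {F. sq_summable F}"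
proof (intro equalityI subsetI)
  fix f assume f: "f \<in> H2"
  then have holo: "f holomorphic_on eball 0 1" and zero: "\<And>z. \<not> norm z < 1 \<Longrightarrow> f z = 0"
    and bdd: "bdd_above ((\<lambda>r. LINT w|circle_measure. (norm (f (of_real r * w)))\<^sup>2) ` {0..<1})"
    by (auto simp: H2_def one_ereal_def)
  define F where "F = fps_expansion f 0"
  have f_eq: "f = hardy F"
    using eval_fps_expansion'[OF holo] zero by (auto simp: F_def hardy_def fun_eq_iff one_ereal_def)
  have radius: "fps_conv_radius F \<ge> 1"
    unfolding F_def by (rule conv_radius_fps_expansion[OF holo])
  from bdd obtain B where B: "\<And>r. 0 \<le> r \<Longrightarrow> r < 1 \<Longrightarrow>
      (LINT w|circle_measure. (norm (f (of_real r * w)))\<^sup>2) \<le> B"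
    by (fastforce simp: bdd_above_def)
  have "sq_summable F"
    unfolding sq_summable_def
  proof (rule summableI_nonneg_bounded)
    fix M :: nat
    show "(\<Sum>n<M. (norm (F $ n))\<^sup>2) \<le> B"
    proof (rule tendsto_upperbound)
      show "((\<lambda>r. \<Sum>n<M. (r ^ n * norm (F $ n))\<^sup>2) \<longlongrightarrow> (\<Sum>n<M. (norm (F $ n))\<^sup>2)) (at_left 1)"
        by (auto intro!: tendsto_eq_intros)
      show "\<forall>\<^sub>F r in at_left 1. (\<Sum>n<M. (r ^ n * norm (F $ n))\<^sup>2) \<le> B"
        using eventually_at_left_1
      proof eventually_elim
        case (elim r)
        have "summable (\<lambda>n. norm (F $ n * of_real r ^ n))"
          using elim less_le_trans[OF _ radius, of "ereal r"]
          by (intro norm_summable_fps) (simp add: one_ereal_def)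
        then have *: "summable (\<lambda>n. norm (dilate r F $ n))"
          by (simp add: mult.commute)
        have "(\<Sum>n<M. (r ^ n * norm (F $ n))\<^sup>2) \<le> (LINT w|circle_measure. (norm (f (of_real r * w)))\<^sup>2)"
          using integral_norm_hardy_sums[OF *] elim unfolding f_eq
          by (intro sum_le_suminf[of "\<lambda>n. (r ^ n * norm (F $ n))\<^sup>2" "{..<M}", THEN order_trans])
            (auto simp: sums_iff)
        also have "\<dots> \<le> B" using B elim by simp
        finally show ?case .
      qed
    qed simp
  qed simp
  then show "f \<in> hardy ` {F. sq_summable F}"
    using f_eq by blast
qed (auto intro: hardy_in_H2)

lemma inj_on_hardy: "inj_on hardy {F. sq_summable F}"
proof (rule inj_onI)
  fix F G assume "F \<in> {F. sq_summable F}" "G \<in> {F. sq_summable F}" and eq: "hardy F = hardy G"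
  then have radius: "fps_conv_radius F > 0" "fps_conv_radius G > 0"
    using sq_summable_imp_conv_radius[of F] sq_summable_imp_conv_radius[of G]
    by (auto intro: less_le_trans[of 0 "1 :: ereal"])
  have "eventually (\<lambda>z. z \<in> ball 0 1) (nhds (0::complex))"
    by (intro eventually_nhds_in_open) auto
  then have "eventually (\<lambda>z. eval_fps F z = eval_fps G z) (nhds 0)"
    by eventually_elim (use eq in \<open>auto simp: hardy_def fun_eq_iff split: if_splits\<close>)
  with radius show "F = G"
    by (intro eval_fps_eqD)
qed

lemma hardy_eq_iff: "sq_summable F \<Longrightarrow> sq_summable G \<Longrightarrow> hardy F = hardy G \<longleftrightarrow> F = G"
  using inj_on_hardy by (auto simp: inj_on_def)

lemma is_boundary_function_boundary_function:
  "sq_summable F \<Longrightarrow> is_boundary_function (hardy F) (boundary_function (hardy F))"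
  unfolding boundary_function_def by (rule someI_ex[OF ex_is_boundary_function])

lemma boundary_function_L2: "sq_summable F \<Longrightarrow> boundary_function (hardy F) \<in> L2_circle"
  using is_boundary_function_boundary_function by (auto simp: is_boundary_function_def)

text \<open>The boundary function is only chosen by \<open>SOME\<close>. Its inner products become
  computable as limits of inner products of dilates, which are given by absolutely convergent
  series.\<close>

lemma tendsto_L2_inner_dilate:
  assumes F: "sq_summable F" and G: "G \<in> L2_circle"
  shows "((\<lambda>r. L2_inner (eval_fps (dilate r F)) G) \<longlongrightarrow> L2_inner (boundary_function (hardy F)) G) (at_left 1)"
proof (rule tendsto_L2_inner)
  have "((\<lambda>r. LINT w|circle_measure. (norm (hardy F (of_real r * w) - boundary_function (hardy F) w))\<^sup>2) \<longlongrightarrow> 0)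
      (at_left (1::real))"
    using is_boundary_function_boundary_function[OF F] by (simp add: is_boundary_function_def)
  moreover have "\<forall>\<^sub>F r in at_left 1.
      (LINT w|circle_measure. (norm (hardy F (of_real r * w) - boundary_function (hardy F) w))\<^sup>2) =
      (LINT w|circle_measure. (norm (eval_fps (dilate r F) w - boundary_function (hardy F) w))\<^sup>2)"
    using eventually_at_left_1
  proof eventually_elim
    case (elim r)
    have [measurable]: "boundary_function (hardy F) \<in> borel_measurable borel"
      by (rule L2_circle_measurable[OF boundary_function_L2[OF F]])
    show ?case
    proof (rule integral_cong_AE)
      show "AE w in circle_measure. (norm (hardy F (of_real r * w) - boundary_function (hardy F) w))\<^sup>2 =
          (norm (eval_fps (dilate r F) w - boundary_function (hardy F) w))\<^sup>2"
        using AE_circle_norm by eventually_elim (use elim in \<open>simp add: hardy_dilate\<close>)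
    qed measurable
  qed
  ultimately show "((\<lambda>r. LINT w|circle_measure. (norm (eval_fps (dilate r F) w - boundary_function (hardy F) w))\<^sup>2)
      \<longlongrightarrow> 0) (at_left 1)"
    by (rule Lim_transform_eventually)
  show "\<forall>\<^sub>F r in at_left 1. eval_fps (dilate r F) \<in> L2_circle"
    using eventually_at_left_1
    by eventually_elim (auto intro!: eval_fps_L2_circle summable_norm_dilate F)
qed (use F G boundary_function_L2 in auto)

lemma power_L2_circle: "(\<lambda>w. w ^ n) \<in> L2_circle"
  by (rule L2_circle_bounded[where B = 1])
    (auto simp: norm_power intro!: borel_measurable_continuous_onI continuous_intros)

text \<open>The dilate by \<open>r\<close> has the coefficient \<open>of_real r ^ n * F $ n\<close>;
  let \<open>r\<close> tend to 1.\<close>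

lemma fourier_coeff_boundary_function:
  assumes F: "sq_summable F"
  shows "L2_inner (boundary_function (hardy F)) (\<lambda>w. w ^ n) = F $ n"
proof (rule tendsto_unique)
  show "((\<lambda>r. L2_inner (eval_fps (dilate r F)) (\<lambda>w. w ^ n)) \<longlongrightarrow>
      L2_inner (boundary_function (hardy F)) (\<lambda>w. w ^ n)) (at_left 1)"
    by (intro tendsto_L2_inner_dilate F power_L2_circle)
  have "((\<lambda>r. of_real r ^ n * F $ n) \<longlongrightarrow> of_real 1 ^ n * F $ n) (at_left 1)"
    by (intro tendsto_intros)
  moreover have "\<forall>\<^sub>F r in at_left 1. of_real r ^ n * F $ n = L2_inner (eval_fps (dilate r F)) (\<lambda>w. w ^ n)"
    using eventually_at_left_1
    by eventually_elim (unfold L2_inner_def, subst fourier_coeff_eval_fps,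
        auto intro!: summable_norm_dilate F simp del: dilate_nth, simp)
  ultimately show "((\<lambda>r. L2_inner (eval_fps (dilate r F)) (\<lambda>w. w ^ n)) \<longlongrightarrow> F $ n) (at_left 1)"
    by (auto intro: Lim_transform_eventually)
qed simp

lemma L2_inner_eval_fps_sums:
  assumes G: "G \<in> L2_circle" and F: "summable (\<lambda>n. norm (F $ n))"
  shows "(\<lambda>n. cnj (F $ n) * L2_inner G (\<lambda>w. w ^ n)) sums L2_inner G (eval_fps F)"
proof -
  have "integrable circle_measure G"
    using integrable_mult_cnj_L2[OF G L2_circle_const[of 1]] by simp
  then show ?thesis
    unfolding L2_inner_def by (rule sums_integral_cnj_eval_fps[OF _ F])
qed

text \<open>Orthogonality to the monomials passes to all dilates by summation and to the boundary
  function in the limit, so orthogonality to the Hardy space can be tested on monomials.\<close>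

lemma L2_inner_boundary_function_eq_0:
  assumes G: "G \<in> L2_circle" and orth: "\<And>n. L2_inner G (\<lambda>w. w ^ n) = 0" and F: "sq_summable F"
  shows "L2_inner G (boundary_function (hardy F)) = 0"
proof -
  have "\<forall>\<^sub>F r in at_left 1. 0 = L2_inner (eval_fps (dilate r F)) G"
    using eventually_at_left_1
  proof eventually_elim
    case (elim r)
    then have "(\<lambda>n. 0) sums L2_inner G (eval_fps (dilate r F))"
      using L2_inner_eval_fps_sums[OF G, of "dilate r F"] orth summable_norm_dilate[OF F, of r]
      by simp
    then show ?case
      by (subst L2_inner_commute) (simp add: sums_iff)
  qed
  then have "((\<lambda>r. L2_inner (eval_fps (dilate r F)) G) \<longlongrightarrow> 0) (at_left 1)"
    by (rule Lim_transform_eventually[OF tendsto_const])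
  then have "L2_inner (boundary_function (hardy F)) G = 0"
    using tendsto_L2_inner_dilate[OF F G] by (intro tendsto_unique[of "at_left (1::real)"]) auto
  then show ?thesis by (subst L2_inner_commute) simp
qed

lemma finite_support_imp_sq_summable:
  fixes F :: "complex fps"
  assumes "\<And>n. n \<ge> N \<Longrightarrow> F $ n = 0"
  shows "sq_summable F"
  unfolding sq_summable_def by (rule summable_finite[of "{..<N}"]) (use assms in auto)

text \<open>Even for a polynomial the boundary function is a chosen representative, so the value is
  again reached through dilates; the sum being finite, the limit can be taken term by term.\<close>

lemma L2_inner_boundary_function_finite:
  fixes F :: "complex fps"
  assumes G: "G \<in> L2_circle" and F: "\<And>n. n \<ge> N \<Longrightarrow> F $ n = 0"
  shows "L2_inner G (boundary_function (hardy F)) = (\<Sum>n<N. cnj (F $ n) * L2_inner G (\<lambda>w. w ^ n))"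
    (is "_ = ?S")
proof -
  have sq: "sq_summable F" using F by (rule finite_support_imp_sq_summable)
  have "((\<lambda>r. cnj (\<Sum>n<N. cnj (of_real r ^ n * F $ n) * L2_inner G (\<lambda>w. w ^ n))) \<longlongrightarrow>
      cnj (\<Sum>n<N. cnj (of_real 1 ^ n * F $ n) * L2_inner G (\<lambda>w. w ^ n))) (at_left 1)"
    by (intro tendsto_intros)
  moreover have "\<forall>\<^sub>F r in at_left 1. cnj (\<Sum>n<N. cnj (of_real r ^ n * F $ n) * L2_inner G (\<lambda>w. w ^ n)) =
      L2_inner (eval_fps (dilate r F)) G"
    using eventually_at_left_1
  proof eventually_elim
    case (elim r)
    have "(\<lambda>n. cnj (dilate r F $ n) * L2_inner G (\<lambda>w. w ^ n)) sums L2_inner G (eval_fps (dilate r F))"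
      using elim by (intro L2_inner_eval_fps_sums G summable_norm_dilate sq) auto
    moreover have "(\<lambda>n. cnj (dilate r F $ n) * L2_inner G (\<lambda>w. w ^ n)) sums
        (\<Sum>n<N. cnj (dilate r F $ n) * L2_inner G (\<lambda>w. w ^ n))"
      by (rule sums_finite) (auto simp: F)
    ultimately have "L2_inner G (eval_fps (dilate r F)) = (\<Sum>n<N. cnj (dilate r F $ n) * L2_inner G (\<lambda>w. w ^ n))"
      by (rule sums_unique2)
    then show ?case by (subst L2_inner_commute) simp
  qed
  ultimately have "((\<lambda>r. L2_inner (eval_fps (dilate r F)) G) \<longlongrightarrow> cnj ?S) (at_left 1)"
    by (auto intro: Lim_transform_eventually)
  then have "L2_inner (boundary_function (hardy F)) G = cnj ?S"
    using tendsto_L2_inner_dilate[OF sq G] by (intro tendsto_unique[of "at_left (1::real)"]) auto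
  then show ?thesis by (subst L2_inner_commute) simp
qed

text \<open>In every inner product evaluated later one of the two arguments is a polynomial, which
  makes the coefficient formula a finite sum.\<close>

lemma H2_inner_finite_right:
  fixes F G :: "complex fps"
  assumes F: "sq_summable F" and G: "\<And>n. n \<ge> N \<Longrightarrow> G $ n = 0"
  shows "H2_inner (hardy F) (hardy G) = (\<Sum>n<N. F $ n * cnj (G $ n))"
  unfolding H2_inner_def
  by (subst L2_inner_boundary_function_finite[OF boundary_function_L2[OF F] G])
    (auto simp: fourier_coeff_boundary_function[OF F] mult.commute)

lemma H2_inner_commute: "H2_inner f g = cnj (H2_inner g f)"
  unfolding H2_inner_def by (rule L2_inner_commute)

text \<open>The projection retains the Fourier coefficients of nonnegative index. Uniqueness for
  \<open>THE\<close> comes from testing a competitor against the monomials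
  \<open>fps_X ^ n\<close>.\<close>

lemma riesz_projection_eqI:
  assumes G: "G \<in> L2_circle" and H: "sq_summable H" and coeff: "\<And>n. L2_inner G (\<lambda>w. w ^ n) = H $ n"
  shows "riesz_projection G = hardy H"
  unfolding riesz_projection_def
proof (rule the_equality)
  have diff: "L2_inner (\<lambda>w. G w - boundary_function (hardy K) w) (\<lambda>w. w ^ n) = H $ n - K $ n"
    if "sq_summable K" for K n
    using that by (subst L2_inner_diff_left)
      (auto simp: G coeff boundary_function_L2 power_L2_circle fourier_coeff_boundary_function)
  show "hardy H \<in> H2 \<and> (\<forall>u\<in>H2. L2_inner (\<lambda>w. G w - boundary_function (hardy H) w) (boundary_function u) = 0)"
    using H G by (auto simp: H2_eq diff boundary_function_L2
        intro!: L2_inner_boundary_function_eq_0 L2_circle_diff)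
  fix h assume h: "h \<in> H2 \<and> (\<forall>u\<in>H2. L2_inner (\<lambda>w. G w - boundary_function h w) (boundary_function u) = 0)"
  then obtain K where K: "h = hardy K" "sq_summable K" by (auto simp: H2_eq)
  have "H $ n - K $ n = 0" for n
  proof -
    have zero: "m \<ge> Suc n \<Longrightarrow> (fps_X ^ n :: complex fps) $ m = 0" for m
      by (simp add: fps_X_power_nth)
    have "hardy (fps_X ^ n) \<in> H2"
      using zero by (intro hardy_in_H2 finite_support_imp_sq_summable)
    then have "0 = L2_inner (\<lambda>w. G w - boundary_function (hardy K) w) (boundary_function (hardy (fps_X ^ n)))"
      using h K by simp
    also have "\<dots> = (\<Sum>m<Suc n. cnj ((fps_X ^ n :: complex fps) $ m) * (H $ m - K $ m))"
      using K zero by (subst L2_inner_boundary_function_finite[of _ "Suc n"])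
        (auto simp: diff intro!: L2_circle_diff G boundary_function_L2)
    also have "\<dots> = H $ n - K $ n"
      by (simp add: fps_X_power_nth)
    finally show ?thesis by simp
  qed
  then show "h = hardy H"
    using K fps_ext[of H K] by simp
qed

section \<open>Operations on square summable series and the Toeplitz operator in
  coefficients\<close>

lemma sq_summable_add:
  assumes "sq_summable F" "sq_summable G"
  shows "sq_summable (F + G)"
  unfolding sq_summable_def
proof (rule summable_comparison_test')
  show "summable (\<lambda>n. 2 * (norm (F $ n))\<^sup>2 + 2 * (norm (G $ n))\<^sup>2)"
    using assms by (intro summable_add summable_mult) (auto simp: sq_summable_def)
  fix n
  have "(norm (F $ n + G $ n))\<^sup>2 \<le> (norm (F $ n) + norm (G $ n))\<^sup>2"
    by (intro power_mono norm_triangle_ineq) auto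
  also have "\<dots> \<le> 2 * (norm (F $ n))\<^sup>2 + 2 * (norm (G $ n))\<^sup>2"
    using sum_squares_bound[of "norm (F $ n)" "norm (G $ n)"] by (simp add: power2_sum)
  finally show "norm ((norm ((F + G) $ n))\<^sup>2) \<le> 2 * (norm (F $ n))\<^sup>2 + 2 * (norm (G $ n))\<^sup>2"
    by simp
qed

lemma sq_summable_cmult: "sq_summable F \<Longrightarrow> sq_summable (fps_const c * F)"
  by (auto simp: sq_summable_def norm_mult power_mult_distrib intro: summable_mult)

lemma sq_summable_shift_iff: "sq_summable (fps_shift k F) \<longleftrightarrow> sq_summable F"
  unfolding sq_summable_def using summable_iff_shift[of "\<lambda>n. (norm (F $ n))\<^sup>2" k] by simp

lemma sq_summable_0: "sq_summable 0"
  by (simp add: sq_summable_def)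

lemma sq_summable_fps_X_power_mult: "sq_summable F \<Longrightarrow> sq_summable (fps_X ^ k * F)"
  using sq_summable_shift_iff[of k "F * fps_X ^ k"]
  by (simp add: fps_shift_times_fps_X_power mult.commute)

lemma sq_summable_poly_mult:
  assumes "sq_summable F"
  shows "sq_summable (fps_of_poly p * F)"
proof (induction p)
  case (pCons c p)
  have "fps_of_poly (pCons c p) * F = fps_const c * F + fps_X ^ 1 * (fps_of_poly p * F)"
    by (simp add: fps_of_poly_pCons algebra_simps)
  moreover have "sq_summable (fps_const c * F + fps_X ^ 1 * (fps_of_poly p * F))"
    using pCons assms by (intro sq_summable_add sq_summable_cmult sq_summable_fps_X_power_mult)
  ultimately show ?case by simp
qed (simp add: sq_summable_0)

text \<open>Multiplying by \<open>cnj (z ^ j)\<close> on the circle and projecting is the j-fold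
  backward shift of the coefficients; the formula extends this to the symbol
  \<open>cnj (poly A z)\<close>.\<close>

definition conj_toeplitz :: "complex poly \<Rightarrow> complex fps \<Rightarrow> complex fps" where
  "conj_toeplitz A F = (\<Sum>j\<le>degree A. fps_const (cnj (coeff A j)) * fps_shift j F)"

lemma conj_toeplitz_nth: "conj_toeplitz A F $ n = (\<Sum>j\<le>degree A. cnj (coeff A j) * F $ (n + j))"
  by (simp add: conj_toeplitz_def fps_sum_nth)

lemma sq_summable_conj_toeplitz:
  assumes "sq_summable F"
  shows "sq_summable (conj_toeplitz A F)"
proof -
  have "sq_summable (\<Sum>j\<in>J. fps_const (cnj (coeff A j)) * fps_shift j F)" if "finite J" for J
    using that by induction
      (use assms in \<open>auto intro!: sq_summable_add sq_summable_cmult simp: sq_summable_0 sq_summable_shift_iff\<close>)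
  then show ?thesis by (simp add: conj_toeplitz_def)
qed

lemma poly_circle_bounded:
  fixes A :: "complex poly"
  assumes "norm w = 1"
  shows "norm (poly A w) \<le> (\<Sum>j\<le>degree A. norm (coeff A j))"
  unfolding poly_altdef
  using norm_sum[of "\<lambda>j. coeff A j * w ^ j" "{..degree A}"] assms by (simp add: norm_mult norm_power)

text \<open>In the n-th Fourier coefficient the factor \<open>cnj (w ^ j)\<close> joins the test
  monomial, which turns it into the coefficient of index \<open>n + j\<close> of the boundary
  function.\<close>

lemma toeplitz_cnj_poly:
  assumes F: "sq_summable F"
  shows "toeplitz (\<lambda>z. cnj (poly A z)) (hardy F) = hardy (conj_toeplitz A F)"
  unfolding toeplitz_def
proof (rule riesz_projection_eqI)
  let ?B = "boundary_function (hardy F)"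
  have poly [measurable]: "poly A \<in> borel_measurable borel"
    by (intro borel_measurable_continuous_onI continuous_intros)
  show "(\<lambda>w. cnj (poly A w) * ?B w) \<in> L2_circle"
    by (rule L2_circle_mult_bounded[OF boundary_function_L2[OF F]])
      (use poly_circle_bounded in auto)
  show "L2_inner (\<lambda>w. cnj (poly A w) * ?B w) (\<lambda>w. w ^ n) = conj_toeplitz A F $ n" for n
  proof -
    have "L2_inner (\<lambda>w. cnj (poly A w) * ?B w) (\<lambda>w. w ^ n) =
        (LINT w|circle_measure. (\<Sum>j\<le>degree A. cnj (coeff A j) * (?B w * cnj (w ^ (n + j)))))"
      unfolding L2_inner_def poly_altdef
      by (intro Bochner_Integration.integral_cong) (auto simp: sum_distrib_left sum_distrib_right power_add mult_ac)
    also have "\<dots> = (\<Sum>j\<le>degree A. (LINT w|circle_measure. cnj (coeff A j) * (?B w * cnj (w ^ (n + j)))))"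
      by (intro Bochner_Integration.integral_sum integrable_mult_right integrable_mult_cnj_L2
          boundary_function_L2 power_L2_circle F)
    also have "\<dots> = (\<Sum>j\<le>degree A. cnj (coeff A j) * L2_inner ?B (\<lambda>w. w ^ (n + j)))"
      by (simp add: L2_inner_def)
    also have "\<dots> = conj_toeplitz A F $ n"
      by (simp add: fourier_coeff_boundary_function[OF F] conj_toeplitz_nth)
    finally show ?thesis .
  qed
qed (rule sq_summable_conj_toeplitz[OF F])

section \<open>Non-tangential limits of derivatives\<close>

text \<open>Cauchy-Schwarz on the partial sums, with the sum of \<open>(norm z ^ n)\<^sup>2\<close>
  estimated by the geometric series of \<open>norm z\<close>.\<close>

lemma hardy_growth:
  assumes F: "sq_summable F" and z: "norm z < 1"
  shows "norm (hardy F z) \<le> sqrt (\<Sum>n. (norm (F $ n))\<^sup>2) / sqrt (1 - norm z)"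
proof -
  let ?S = "\<Sum>n. (norm (F $ n))\<^sup>2"
  have "norm (\<Sum>n<M. F $ n * z ^ n) \<le> sqrt ?S / sqrt (1 - norm z)" for M
  proof -
    have "(norm (\<Sum>n<M. F $ n * z ^ n))\<^sup>2 \<le> (\<Sum>n<M. norm (F $ n) * norm z ^ n)\<^sup>2"
      by (intro power_mono norm_sum[THEN order_trans]) (auto simp: norm_mult norm_power)
    also have "\<dots> \<le> (\<Sum>n<M. (norm (F $ n))\<^sup>2) * (\<Sum>n<M. (norm z ^ n)\<^sup>2)"
      by (rule Cauchy_Schwarz_ineq_sum)
    also have "\<dots> \<le> ?S * (1 / (1 - norm z))"
    proof (rule mult_mono)
      show "(\<Sum>n<M. (norm (F $ n))\<^sup>2) \<le> ?S"
        using F by (intro sum_le_suminf) (auto simp: sq_summable_def)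
      have "(\<Sum>n<M. (norm z ^ n)\<^sup>2) \<le> (\<Sum>n<M. norm z ^ n)"
        using z by (intro sum_mono) (simp add: power2_eq_square mult_left_le_one_le power_le_one)
      also have "\<dots> \<le> (\<Sum>n. norm z ^ n)"
        using z by (intro sum_le_suminf summable_geometric) auto
      also have "\<dots> = 1 / (1 - norm z)"
        using z by (simp add: suminf_geometric)
      finally show "(\<Sum>n<M. (norm z ^ n)\<^sup>2) \<le> 1 / (1 - norm z)" .
      show "0 \<le> ?S" using F by (intro suminf_nonneg) (auto simp: sq_summable_def)
    qed (simp add: sum_nonneg)
    finally have "(norm (\<Sum>n<M. F $ n * z ^ n))\<^sup>2 \<le> ?S / (1 - norm z)"
      by simp
    then show ?thesis
      unfolding real_sqrt_divide[symmetric] by (rule real_le_rsqrt)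
  qed
  moreover have lim: "(\<lambda>M. \<Sum>n<M. F $ n * z ^ n) \<longlonglongrightarrow> eval_fps F z"
    using summable_norm_cancel[OF sq_summable_imp_summable_power[OF F z]]
    unfolding eval_fps_def by (rule summable_LIMSEQ)
  ultimately have "norm (eval_fps F z) \<le> sqrt ?S / sqrt (1 - norm z)"
    by (intro LIMSEQ_le_const2[OF tendsto_norm[OF lim]]) blast
  then show ?thesis
    using z by (simp add: hardy_def)
qed

lemma hardy_mult_poly:
  assumes "sq_summable F"
  shows "hardy (fps_of_poly A * F) z = poly A z * hardy F z"
proof (cases "norm z < 1")
  case True
  then have "ereal (norm z) < fps_conv_radius F"
    using less_le_trans[OF _ sq_summable_imp_conv_radius[OF assms], of "ereal (norm z)"]
    by (simp add: one_ereal_def)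
  with True show ?thesis
    by (simp add: hardy_def eval_fps_mult)
qed (simp add: hardy_def)

lemma hardy_add:
  assumes "sq_summable F" "sq_summable G"
  shows "hardy (F + G) = hardy F + hardy G"
proof
  fix z :: complex
  have "ereal (norm z) < fps_conv_radius F \<and> ereal (norm z) < fps_conv_radius G" if "norm z < 1"
    using that less_le_trans[OF _ sq_summable_imp_conv_radius[OF assms(1)], of "ereal (norm z)"]
      less_le_trans[OF _ sq_summable_imp_conv_radius[OF assms(2)], of "ereal (norm z)"]
    by (simp add: one_ereal_def)
  then show "hardy (F + G) z = (hardy F + hardy G) z"
    by (auto simp: hardy_def eval_fps_add)
qed

lemma hardy_cmult:
  assumes "sq_summable F"
  shows "hardy (fps_const c * F) = (\<lambda>z. c * hardy F z)"
  using hardy_mult_poly[OF assms, of "[:c:]"] by (auto simp: fps_of_poly_const fun_eq_iff)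

lemma hardy_0: "hardy 0 = 0"
  by (auto simp: hardy_def fun_eq_iff)

lemma sq_summable_fps_of_poly: "sq_summable (fps_of_poly P)"
  by (rule finite_support_imp_sq_summable[of "Suc (degree P)"]) (simp add: coeff_eq_0)

lemma hardy_holomorphic: "sq_summable F \<Longrightarrow> hardy F holomorphic_on ball 0 1"
  using hardy_in_H2 by (auto simp: H2_def)

section \<open>Non-tangential limits and their uniqueness\<close>

lemma stolz_region_accumulates:
  assumes "norm \<zeta> = 1" "\<alpha> > 1"
  shows "at \<zeta> within stolz_region \<alpha> \<zeta> \<noteq> bot"
proof -
  have "\<zeta> islimpt stolz_region \<alpha> \<zeta>"
    unfolding islimpt_approachable
  proof (intro allI impI)
    fix e :: real assume "e > 0"
    \<comment> \<open>The witnesses are the points \<open>(1 - t) * \<zeta>\<close> on the radius: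
      their distance to \<open>\<zeta>\<close> equals \<open>1 - norm z\<close>, so they lie in
      every region with \<open>\<alpha> > 1\<close>.\<close>
    define t where "t = min (e / 2) (1 / 2)"
    have t: "0 < t" "t < 1" "t < e" using \<open>e > 0\<close> by (auto simp: t_def)
    have "of_real (1 - t) * \<zeta> - \<zeta> = - of_real t * \<zeta>"
      by (simp add: algebra_simps)
    then have dist: "norm (of_real (1 - t) * \<zeta> - \<zeta>) = t"
      using t assms(1) by (simp add: norm_mult flip: of_real_minus)
    have "norm (of_real (1 - t) * \<zeta>) = 1 - t"
      using t assms(1) by (simp add: norm_mult norm_of_real del: of_real_diff)
    then have "of_real (1 - t) * \<zeta> \<in> stolz_region \<alpha> \<zeta>"
      using t assms(2) dist by (simp add: stolz_region_def)
    moreover have "of_real (1 - t) * \<zeta> \<noteq> \<zeta>" using dist t by auto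
    ultimately show "\<exists>x'\<in>stolz_region \<alpha> \<zeta>. x' \<noteq> \<zeta> \<and> dist x' \<zeta> < e"
      using dist t
      by (intro bexI[of _ "of_real (1 - t) * \<zeta>"]) (simp_all add: dist_norm del: of_real_diff)
  qed
  then show ?thesis by (simp add: trivial_limit_within)
qed

lemma has_nontangential_limit_unique:
  assumes "has_nontangential_limit f L \<zeta>" "has_nontangential_limit f L' \<zeta>" "norm \<zeta> = 1"
  shows "L = L'"
proof (rule tendsto_unique)
  show "at \<zeta> within stolz_region 2 \<zeta> \<noteq> bot"
    using assms(3) by (rule stolz_region_accumulates) simp
  show "(f \<longlongrightarrow> L) (at \<zeta> within stolz_region 2 \<zeta>)" "(f \<longlongrightarrow> L') (at \<zeta> within stolz_region 2 \<zeta>)"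
    using assms by (simp_all add: has_nontangential_limit_def)
qed

text \<open>Let \<open>\<delta> = 1 - norm z\<close>. On the circle of radius
  \<open>\<delta> / 2\<close> around \<open>z\<close>, the zero of \<open>A\<close> contributes a
  factor of order \<open>\<delta> ^ m\<close>, and \<open>hardy F\<close> grows at most like
  \<open>1 / sqrt \<delta>\<close>. Cauchy's estimate costs \<open>\<delta> ^ l\<close>, and since
  \<open>l < m\<close> a factor \<open>sqrt \<delta>\<close> remains.\<close>

lemma has_nontangential_limit_higher_deriv_0:
  assumes F: "sq_summable F" and \<zeta>: "norm \<zeta> = 1" and dvd: "[:-\<zeta>, 1:] ^ m dvd A" and "l < m"
  shows "has_nontangential_limit ((deriv ^^ l) (hardy (fps_of_poly A * F))) 0 \<zeta>"
  unfolding has_nontangential_limit_def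
proof (intro allI impI)
  fix \<alpha> :: real assume "\<alpha> > 1"
  from dvd obtain B where A: "A = [:-\<zeta>, 1:] ^ m * B" ..
  define K where "K = (\<Sum>j\<le>degree B. norm (coeff B j))"
  have K: "norm (poly B x) \<le> K" if "norm x \<le> 1" for x
    unfolding poly_altdef K_def
    using that by (intro norm_sum[THEN order_trans] sum_mono)
      (auto simp: norm_mult norm_power intro!: mult_left_le power_le_one)
  have "K \<ge> 0" by (simp add: K_def sum_nonneg)
  define C where "C = sqrt (\<Sum>n. (norm (F $ n))\<^sup>2)"
  have "C \<ge> 0"
    using F by (auto simp: C_def sq_summable_def intro!: suminf_nonneg)
  \<comment> \<open>\<open>\<alpha> + 1\<close> bounds the distance to \<open>\<zeta>\<close> in
    units of \<open>\<delta>\<close>, \<open>K\<close> the cofactor on the disk, and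
    \<open>C\<close> the growth of \<open>hardy F\<close>; \<open>sqrt 2\<close> and
    \<open>2 ^ l\<close> come from the radius \<open>\<delta> / 2\<close>.\<close>
  define D where "D = fact l * ((\<alpha> + 1) ^ m * K * C * sqrt 2 * 2 ^ l)"
  have "D \<ge> 0"
    using \<open>K \<ge> 0\<close> \<open>C \<ge> 0\<close> \<open>\<alpha> > 1\<close> by (simp add: D_def)
  let ?f = "hardy (fps_of_poly A * F)"
  have holo: "?f holomorphic_on ball 0 1"
    by (intro hardy_holomorphic sq_summable_poly_mult F)
  have bound: "norm ((deriv ^^ l) ?f z) \<le> D * sqrt (1 - norm z)" if z: "z \<in> stolz_region \<alpha> \<zeta>" for z
  proof -
    define \<delta> where "\<delta> = 1 - norm z"
    have \<delta>: "0 < \<delta>" "\<delta> \<le> 1" and dist: "norm (z - \<zeta>) < \<alpha> * \<delta>"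
      using z by (auto simp: stolz_region_def \<delta>_def)
    have sub: "cball z (\<delta> / 2) \<subseteq> ball 0 1"
    proof
      fix x assume "x \<in> cball z (\<delta> / 2)"
      then have "norm (z - x) \<le> \<delta> / 2" by (simp add: dist_norm)
      then show "x \<in> ball 0 1"
        using norm_triangle_ineq2[of x z] \<delta> by (simp add: \<delta>_def norm_minus_commute)
    qed
    have "norm ((deriv ^^ l) ?f z) \<le> fact l * (((\<alpha> + 1) * \<delta>) ^ m * K * (C / sqrt (\<delta> / 2))) / (\<delta> / 2) ^ l"
    proof (rule Cauchy_inequality)
      show "?f holomorphic_on ball z (\<delta> / 2)"
        by (rule holomorphic_on_subset[OF holo]) (use sub ball_subset_cball in blast)
      show "continuous_on (cball z (\<delta> / 2)) ?f"
        by (rule holomorphic_on_imp_continuous_on[OF holomorphic_on_subset[OF holo sub]])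
      fix x assume x: "norm (z - x) = \<delta> / 2"
      have "norm x \<le> 1 - \<delta> / 2"
        using norm_triangle_ineq2[of x z] x norm_minus_commute[of x z] unfolding \<delta>_def by argo
      then have nx: "norm x < 1" "\<delta> / 2 \<le> 1 - norm x" using \<delta> by auto
      have "norm (x - \<zeta>) \<le> norm (z - \<zeta>) + norm (z - x)"
        using norm_triangle_ineq4[of "z - \<zeta>" "z - x"] by simp
      also have "\<dots> \<le> (\<alpha> + 1) * \<delta>"
        using x dist \<delta> by (simp add: algebra_simps)
      finally have "norm (x - \<zeta>) ^ m \<le> ((\<alpha> + 1) * \<delta>) ^ m"
        by (intro power_mono) auto
      moreover have "norm (hardy F x) \<le> C / sqrt (\<delta> / 2)"
      proof -
        have "norm (hardy F x) \<le> C / sqrt (1 - norm x)"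
          unfolding C_def using nx by (intro hardy_growth F)
        also have "\<dots> \<le> C / sqrt (\<delta> / 2)"
          using nx \<delta> \<open>C \<ge> 0\<close> by (intro divide_left_mono) auto
        finally show ?thesis .
      qed
      moreover have "norm (?f x) = norm (x - \<zeta>) ^ m * norm (poly B x) * norm (hardy F x)"
        by (simp add: hardy_mult_poly[OF F] A norm_mult norm_power poly_power)
      moreover have "norm (poly B x) \<le> K" using nx by (intro K) simp
      ultimately show "norm (?f x) \<le> ((\<alpha> + 1) * \<delta>) ^ m * K * (C / sqrt (\<delta> / 2))"
        using \<open>K \<ge> 0\<close> \<open>\<alpha> > 1\<close> \<delta> by (simp only:) (intro mult_mono; simp)
    qed (use \<delta> in simp)
    also have "\<dots> = D * (\<delta> ^ m / \<delta> ^ l / sqrt \<delta>)"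
      unfolding D_def power_mult_distrib[of "\<alpha> + 1" \<delta> m]
      using \<delta> by (simp add: real_sqrt_divide power_divide field_simps)
    \<comment> \<open>One factor \<open>\<delta>\<close> is split off to absorb
      \<open>1 / sqrt \<delta>\<close>; the subtraction is exact because
      \<open>l < m\<close>.\<close>
    also have "\<delta> ^ m / \<delta> ^ l / sqrt \<delta> = \<delta> ^ (m - l - 1) * (\<delta> / sqrt \<delta>)"
      using \<delta> \<open>l < m\<close> by (simp add: power_diff[symmetric] flip: power_Suc2 Suc_diff_Suc)
    also have "\<dots> \<le> 1 * sqrt \<delta>"
      using \<delta> by (intro mult_mono power_le_one) (auto simp: real_div_sqrt)
    finally show ?thesis
      using \<open>D \<ge> 0\<close> by (simp add: \<delta>_def mult_left_mono)
  qed
  show "((deriv ^^ l) ?f \<longlongrightarrow> 0) (at \<zeta> within stolz_region \<alpha> \<zeta>)"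
  proof (rule Lim_null_comparison)
    show "\<forall>\<^sub>F z in at \<zeta> within stolz_region \<alpha> \<zeta>. norm ((deriv ^^ l) ?f z) \<le> D * sqrt (1 - norm z)"
      using bound by (auto simp: eventually_at_filter)
    show "((\<lambda>z. D * sqrt (1 - norm z)) \<longlongrightarrow> 0) (at \<zeta> within stolz_region \<alpha> \<zeta>)"
      using \<zeta> by (auto intro!: tendsto_eq_intros)
  qed
qed

lemma higher_deriv_poly: "(deriv ^^ l) (poly p) = poly ((pderiv ^^ l) (p :: complex poly))"
proof (induction l)
  case (Suc l)
  have "deriv (poly q) = poly (pderiv q)" for q :: "complex poly"
    by (intro ext DERIV_imp_deriv poly_DERIV)
  with Suc show ?case by simp
qed simp

text \<open>The multiple of \<open>A\<close> contributes 0 and the polynomial is continuous at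
  \<open>\<zeta>\<close>. By \<open>conj_toeplitz_split\<close> the images under the Toeplitz
  operator have this form, so the lemma evaluates the boundary functionals on the whole
  range.\<close>

lemma has_nontangential_limit_higher_deriv_mult_add_poly:
  assumes F: "sq_summable F" and \<zeta>: "norm \<zeta> = 1" and dvd: "[:-\<zeta>, 1:] ^ m dvd A" and "l < m"
  shows "has_nontangential_limit ((deriv ^^ l) (hardy (fps_of_poly A * F + fps_of_poly Q)))
    (poly ((pderiv ^^ l) Q) \<zeta>) \<zeta>"
  unfolding has_nontangential_limit_def
proof (intro allI impI)
  fix \<alpha> :: real assume "\<alpha> > 1"
  let ?g = "hardy (fps_of_poly A * F)"
  have AF: "sq_summable (fps_of_poly A * F)" by (intro sq_summable_poly_mult F)
  have "((\<lambda>z. (deriv ^^ l) ?g z + poly ((pderiv ^^ l) Q) z) \<longlongrightarrow> 0 + poly ((pderiv ^^ l) Q) \<zeta>)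
      (at \<zeta> within stolz_region \<alpha> \<zeta>)"
    using has_nontangential_limit_higher_deriv_0[OF assms] \<open>\<alpha> > 1\<close>
    by (intro tendsto_add tendsto_intros) (auto simp: has_nontangential_limit_def)
  moreover have "(deriv ^^ l) ?g z + poly ((pderiv ^^ l) Q) z =
      (deriv ^^ l) (hardy (fps_of_poly A * F + fps_of_poly Q)) z" if "z \<in> stolz_region \<alpha> \<zeta>" for z
  proof -
    have z: "z \<in> ball 0 1" using that by (simp add: stolz_region_def)
    have "(deriv ^^ l) (hardy (fps_of_poly A * F + fps_of_poly Q)) z = (deriv ^^ l) (\<lambda>w. ?g w + poly Q w) z"
    proof (rule higher_deriv_transform_within_open[OF _ _ open_ball z])
      show "hardy (fps_of_poly A * F + fps_of_poly Q) holomorphic_on ball 0 1"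
        by (intro hardy_holomorphic sq_summable_add AF sq_summable_fps_of_poly)
      show "(\<lambda>w. ?g w + poly Q w) holomorphic_on ball 0 1"
        by (intro holomorphic_intros hardy_holomorphic AF)
      show "hardy (fps_of_poly A * F + fps_of_poly Q) w = ?g w + poly Q w" if "w \<in> ball 0 1" for w
        using that by (simp add: hardy_add AF sq_summable_fps_of_poly) (simp add: hardy_def)
    qed
    also have "\<dots> = (deriv ^^ l) ?g z + (deriv ^^ l) (poly Q) z"
      by (rule higher_deriv_add[OF hardy_holomorphic[OF AF] _ open_ball z]) (intro holomorphic_intros)
    finally show ?thesis by (simp add: higher_deriv_poly)
  qed
  then have "\<forall>\<^sub>F z in at \<zeta> within stolz_region \<alpha> \<zeta>. (deriv ^^ l) ?g z + poly ((pderiv ^^ l) Q) z =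
      (deriv ^^ l) (hardy (fps_of_poly A * F + fps_of_poly Q)) z"
    by (auto simp: eventually_at_filter)
  ultimately show "((deriv ^^ l) (hardy (fps_of_poly A * F + fps_of_poly Q)) \<longlongrightarrow> poly ((pderiv ^^ l) Q) \<zeta>)
      (at \<zeta> within stolz_region \<alpha> \<zeta>)"
    by (auto intro: Lim_transform_eventually)
qed

section \<open>Orders of vanishing of polynomials\<close>

lemma higher_pderiv_linear_mult:
  fixes r :: "'a::idom poly"
  shows "poly ((pderiv ^^ Suc l) ([:-a, 1:] * r)) a = of_nat (Suc l) * poly ((pderiv ^^ l) r) a"
proof -
  \<comment> \<open>Leibniz's rule for a linear factor: its second derivative is 0, so only two
    terms occur, and the first of them vanishes at \<open>a\<close>.\<close>
  have "(pderiv ^^ Suc l) ([:-a, 1:] * r) =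
      [:-a, 1:] * (pderiv ^^ Suc l) r + smult (of_nat (Suc l)) ((pderiv ^^ l) r)" for l
  proof (induction l)
    case 0
    show ?case by (simp add: pderiv_mult pderiv_pCons del: mult_pCons_left)
  next
    case (Suc l)
    have "(pderiv ^^ Suc (Suc l)) ([:-a, 1:] * r) = pderiv ((pderiv ^^ Suc l) ([:-a, 1:] * r))"
      by simp
    also have "\<dots> = [:-a, 1:] * (pderiv ^^ Suc (Suc l)) r + (pderiv ^^ Suc l) r +
        smult (of_nat (Suc l)) ((pderiv ^^ Suc l) r)"
      unfolding Suc by (simp add: pderiv_mult pderiv_add pderiv_smult pderiv_pCons del: mult_pCons_left)
    also have "\<dots> = [:-a, 1:] * (pderiv ^^ Suc (Suc l)) r + smult (of_nat (Suc (Suc l))) ((pderiv ^^ Suc l) r)"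
      by (simp only: of_nat_Suc[of "Suc l"] smult_add_left smult_1_left add.assoc)
    finally show ?case .
  qed
  then show ?thesis by simp
qed

text \<open>One linear factor is split off per induction step. Characteristic 0 makes the factor
  \<open>of_nat (Suc l)\<close> nonzero, so the vanishing derivatives pass to the quotient.\<close>

lemma linear_power_dvd_if_higher_pderiv_eq_0:
  fixes p :: "'a::{idom, ring_char_0} poly"
  assumes "\<And>l. l < m \<Longrightarrow> poly ((pderiv ^^ l) p) a = 0"
  shows "[:-a, 1:] ^ m dvd p"
  using assms
proof (induction m arbitrary: p)
  case (Suc m)
  have "poly p a = 0" using Suc.prems[of 0] by simp
  then obtain r where p: "p = [:-a, 1:] * r" by (auto simp: poly_eq_0_iff_dvd)
  have "poly ((pderiv ^^ l) r) a = 0" if "l < m" for l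
    using Suc.prems[of "Suc l"] that higher_pderiv_linear_mult[of l a r]
    unfolding p by (simp del: funpow.simps mult_pCons_left of_nat_Suc)
  then have "[:-a, 1:] ^ m dvd r" by (rule Suc.IH)
  then show ?case unfolding p by (simp add: mult_dvd_mono del: mult_pCons_left)
qed simp

text \<open>The product of the powers already collected does not vanish at the new root, because the
  roots are distinct; hence the whole multiplicity there belongs to the cofactor.\<close>

lemma prod_linear_power_dvd:
  fixes p :: "'a::idom poly"
  assumes "finite J" "inj_on \<zeta> J" "\<And>j. j \<in> J \<Longrightarrow> [:-\<zeta> j, 1:] ^ m j dvd p"
  shows "(\<Prod>j\<in>J. [:-\<zeta> j, 1:] ^ m j) dvd p"
  using assms
proof (induction J)
  case (insert i J)
  let ?q = "\<Prod>j\<in>J. [:-\<zeta> j, 1:] ^ m j"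
  obtain r where p: "p = ?q * r"
    using insert by (auto elim!: dvdE)
  have "?q \<noteq> 0"
    using insert.hyps by simp
  have "[:-\<zeta> i, 1:] ^ m i dvd r"
  proof (cases "p = 0")
    case False
    have "poly ?q (\<zeta> i) \<noteq> 0"
      using insert.hyps insert.prems(1) by (auto simp: poly_prod poly_power)
    then have "order (\<zeta> i) ?q = 0" by (rule order_0I)
    then have "order (\<zeta> i) p = order (\<zeta> i) r"
      using False p order_mult[of ?q r] by simp
    moreover have "m i \<le> order (\<zeta> i) p"
      using insert.prems(2)[of i] False by (simp add: order_divides)
    ultimately show ?thesis by (simp add: order_divides)
  qed (use p \<open>?q \<noteq> 0\<close> in auto)
  then have "[:-\<zeta> i, 1:] ^ m i * ?q dvd r * ?q"
    by (intro mult_dvd_mono) auto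
  then show ?case
    using insert.hyps p by (simp add: mult.commute)
qed simp

section \<open>The co-analytic Toeplitz operator on power series\<close>

lemma conj_toeplitz_add: "conj_toeplitz A (F + G) = conj_toeplitz A F + conj_toeplitz A G"
  by (simp add: conj_toeplitz_def fps_shift_add distrib_left sum.distrib)

lemma conj_toeplitz_diff: "conj_toeplitz A (F - G) = conj_toeplitz A F - conj_toeplitz A G"
  by (simp add: conj_toeplitz_def fps_shift_diff right_diff_distrib sum_subtractf)

lemma conj_toeplitz_cmult: "conj_toeplitz A (fps_const c * F) = fps_const c * conj_toeplitz A F"
  by (rule fps_ext) (simp add: conj_toeplitz_nth sum_distrib_left mult_ac)

text \<open>On the unit circle this says \<open>cnj (a z) = \<kappa> z\<^sup>-\<^sup>N a z\<close> for a polynomial \<open>a\<close> of degree \<open>N\<close>.\<close>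

definition self_inversive :: "complex \<Rightarrow> complex poly \<Rightarrow> bool" where
  "self_inversive \<kappa> A \<longleftrightarrow> \<kappa> \<noteq> 0 \<and> A \<noteq> 0 \<and>
    (\<forall>j\<le>degree A. cnj (coeff A j) = \<kappa> * coeff A (degree A - j))"

section \<open>Self-inversive polynomials and the shift form of the operator\<close>

lemma map_poly_cnj_prod_linear:
  "map_poly cnj (\<Prod>j\<in>J. [:-\<zeta> j, 1:] ^ m j) = (\<Prod>j\<in>J. [:- cnj (\<zeta> j), 1:] ^ m j)"
  by (subst poly_eq_poly_eq_iff[symmetric]) (auto simp: fun_eq_iff poly_prod poly_power)

lemma self_inversiveI:
  assumes "k \<noteq> 0" "A \<noteq> 0" "reflect_poly A = smult k (map_poly cnj A)"
  shows "self_inversive (inverse k) A"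
proof -
  have "cnj (coeff A j) = inverse k * coeff A (degree A - j)" if "j \<le> degree A" for j
  proof -
    have "coeff A (degree A - j) = coeff (reflect_poly A) j"
      using that by (simp add: coeff_reflect_poly)
    also have "\<dots> = k * cnj (coeff A j)"
      unfolding assms(3) by (simp add: coeff_map_poly)
    finally show ?thesis using assms(1) by simp
  qed
  with assms(1,2) show ?thesis by (simp add: self_inversive_def)
qed

text \<open>For a root on the circle, reversing the coefficients of \<open>z - \<zeta>\<close> gives
  \<open>1 - \<zeta> * z = -\<zeta> * (z - cnj \<zeta>)\<close>. Reversal and conjugation are both
  multiplicative.\<close>

lemma self_inversive_prod_linear:
  assumes J: "finite J" and \<zeta>: "\<And>j. j \<in> J \<Longrightarrow> norm (\<zeta> j) = 1"
  shows "self_inversive (inverse (\<Prod>j\<in>J. (-\<zeta> j) ^ m j)) (\<Prod>j\<in>J. [:-\<zeta> j, 1:] ^ m j)"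
proof -
  let ?A = "\<Prod>j\<in>J. [:-\<zeta> j, 1:] ^ m j" and ?k = "\<Prod>j\<in>J. (-\<zeta> j) ^ m j"
  have "\<zeta> j \<noteq> 0" if "j \<in> J" for j
    using \<zeta>[OF that] by auto
  then have "?k \<noteq> 0" using J by (auto simp: prod_zero_iff)
  have A: "?A \<noteq> 0" using J by (simp add: prod_zero_iff)
  have reflect: "reflect_poly [:-\<zeta> j, 1:] = smult (-\<zeta> j) [:- cnj (\<zeta> j), 1:]" if "j \<in> J" for j
  proof -
    have "\<zeta> j * cnj (\<zeta> j) = 1" "\<zeta> j \<noteq> 0"
      using \<zeta>[OF that] by (auto simp: complex_norm_square[symmetric])
    then show ?thesis by (simp add: reflect_poly_pCons)
  qed
  have "reflect_poly ?A = (\<Prod>j\<in>J. smult ((-\<zeta> j) ^ m j) ([:- cnj (\<zeta> j), 1:] ^ m j))"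
    unfolding reflect_poly_prod reflect_poly_power
    by (intro prod.cong refl) (simp only: reflect smult_power)
  also have "\<dots> = smult ?k (map_poly cnj ?A)"
    by (simp add: prod_smult map_poly_cnj_prod_linear)
  finally show ?thesis
    using \<open>?k \<noteq> 0\<close> A by (intro self_inversiveI)
qed

text \<open>Self-inversiveness replaces the conjugated coefficients by the reversed ones, and the
  backward shifts then add up to the coefficient of index \<open>n + degree A\<close> in the product
  of \<open>A\<close> and \<open>F\<close>.\<close>

lemma conj_toeplitz_eq_shift:
  assumes "self_inversive \<kappa> A"
  shows "conj_toeplitz A F = fps_const \<kappa> * fps_shift (degree A) (fps_of_poly A * F)"
proof (rule fps_ext)
  fix n
  let ?N = "degree A"
  have "(fps_of_poly A * F) $ (n + ?N) = (\<Sum>i=0..n + ?N. coeff A i * F $ (n + ?N - i))"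
    by (simp add: fps_mult_nth)
  also have "\<dots> = (\<Sum>i\<le>?N. coeff A i * F $ (n + ?N - i))"
    by (rule sum.mono_neutral_right) (auto simp: coeff_eq_0)
  also have "\<dots> = (\<Sum>j\<le>?N. coeff A (?N - j) * F $ (n + j))"
    by (rule sum.reindex_bij_witness[of _ "\<lambda>j. ?N - j" "\<lambda>i. ?N - i"]) auto
  finally show "conj_toeplitz A F $ n = (fps_const \<kappa> * fps_shift ?N (fps_of_poly A * F)) $ n"
    using assms by (auto simp: conj_toeplitz_nth self_inversive_def sum_distrib_left mult_ac intro!: sum.cong)
qed

text \<open>The shift formula at the level of polynomials, where derivatives, roots and divisibility
  are at hand.\<close>

definition conj_toeplitz_poly :: "complex \<Rightarrow> complex poly \<Rightarrow> complex poly \<Rightarrow> complex poly" where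
  "conj_toeplitz_poly \<kappa> A P = smult \<kappa> (poly_shift (degree A) (A * P))"

lemma conj_toeplitz_fps_of_poly:
  assumes "self_inversive \<kappa> A"
  shows "conj_toeplitz A (fps_of_poly P) = fps_of_poly (conj_toeplitz_poly \<kappa> A P)"
  by (simp add: conj_toeplitz_eq_shift[OF assms] conj_toeplitz_poly_def fps_of_poly_smult fps_of_poly_mult)

text \<open>Cut \<open>F\<close> after its first \<open>degree A\<close> coefficients. The tail,
  carrying the factor \<open>fps_X ^ degree A\<close>, goes to a multiple of \<open>A\<close>, while
  the head goes to a polynomial. This is the desired decomposition of the range in
  coefficients.\<close>

lemma conj_toeplitz_split:
  assumes "self_inversive \<kappa> A"
  shows "conj_toeplitz A F = fps_of_poly A * (fps_const \<kappa> * fps_shift (degree A) F) +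
    fps_of_poly (conj_toeplitz_poly \<kappa> A (truncate_fps (degree A) F))"
proof -
  let ?N = "degree A"
  have "F = fps_shift ?N F * fps_X ^ ?N + fps_of_poly (truncate_fps ?N F)"
    by (simp add: fps_shift_cutoff)
  then have "conj_toeplitz A F = conj_toeplitz A (fps_shift ?N F * fps_X ^ ?N) +
      conj_toeplitz A (fps_of_poly (truncate_fps ?N F))"
    by (metis conj_toeplitz_add)
  also have "conj_toeplitz A (fps_shift ?N F * fps_X ^ ?N) = fps_of_poly A * (fps_const \<kappa> * fps_shift ?N F)"
    unfolding conj_toeplitz_eq_shift[OF assms] mult.assoc[symmetric] fps_shift_times_fps_X_power'
    by (simp add: mult_ac)
  finally show ?thesis
    by (simp only: conj_toeplitz_fps_of_poly[OF assms])
qed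

text \<open>The product of \<open>A\<close> and \<open>P\<close> has no coefficient from twice
  \<open>degree A\<close> on, and shifting removes \<open>degree A\<close> positions.\<close>

lemma coeff_conj_toeplitz_poly_eq_0:
  assumes P: "\<And>i. i \<ge> degree A \<Longrightarrow> coeff P i = 0" and "n \<ge> degree A"
  shows "coeff (conj_toeplitz_poly \<kappa> A P) n = 0"
proof -
  have "(\<Sum>i\<le>n + degree A. coeff A i * coeff P (n + degree A - i)) = 0"
  proof (intro sum.neutral ballI)
    fix i
    show "coeff A i * coeff P (n + degree A - i) = 0"
      using assms by (cases "i \<le> degree A") (auto simp: coeff_eq_0)
  qed
  then show ?thesis
    by (simp add: conj_toeplitz_poly_def coeff_poly_shift coeff_mult)
qed

lemma eq_0_if_dvd_small:
  fixes A Q :: "'a::idom poly"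
  assumes "A dvd Q" "\<And>i. i \<ge> degree A \<Longrightarrow> coeff Q i = 0"
  shows "Q = 0"
proof (rule ccontr)
  assume "Q \<noteq> 0"
  then have "degree A \<le> degree Q" using assms(1) by (intro dvd_imp_degree_le)
  with assms(2)[of "degree Q"] \<open>Q \<noteq> 0\<close> show False by simp
qed

text \<open>Vanishing of the shifted product means that \<open>A\<close> times \<open>F\<close> is a
  polynomial \<open>Q\<close> of small degree. The boundary values of its derivatives are computed
  twice, as those of a multiple of \<open>A\<close> and as those of a polynomial, so
  \<open>A\<close> divides \<open>Q\<close>.\<close>

lemma conj_toeplitz_eq_0_imp:
  assumes inv: "self_inversive \<kappa> A" and J: "finite J" "inj_on \<zeta> J" "\<And>j. j \<in> J \<Longrightarrow> norm (\<zeta> j) = 1"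
    and A: "A = (\<Prod>j\<in>J. [:-\<zeta> j, 1:] ^ m j)"
    and F: "sq_summable F" and zero: "conj_toeplitz A F = 0"
  shows "F = 0"
proof -
  define Q where "Q = truncate_fps (degree A) (fps_of_poly A * F)"
  have "fps_shift (degree A) (fps_of_poly A * F) = 0"
    using zero inv by (simp add: conj_toeplitz_eq_shift[OF inv] self_inversive_def)
  then have AF: "fps_of_poly A * F = fps_of_poly Q"
    using fps_shift_cutoff[of "degree A" "fps_of_poly A * F"] by (simp add: Q_def)
  have "[:-\<zeta> j, 1:] ^ m j dvd Q" if j: "j \<in> J" for j
  proof (rule linear_power_dvd_if_higher_pderiv_eq_0)
    fix l assume l: "l < m j"
    have dvd: "[:-\<zeta> j, 1:] ^ m j dvd A"
      unfolding A using J j by (intro dvd_prodI)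
    have "has_nontangential_limit ((deriv ^^ l) (hardy (fps_of_poly Q))) 0 (\<zeta> j)"
      unfolding AF[symmetric] by (rule has_nontangential_limit_higher_deriv_0[OF F J(3)[OF j] dvd l])
    \<comment> \<open>The series 0 takes the place of \<open>F\<close> here, which leaves only the
      polynomial.\<close>
    moreover have "has_nontangential_limit ((deriv ^^ l) (hardy (fps_of_poly Q))) (poly ((pderiv ^^ l) Q) (\<zeta> j)) (\<zeta> j)"
      using has_nontangential_limit_higher_deriv_mult_add_poly[OF sq_summable_0 J(3)[OF j] dvd l, of Q]
      by simp
    ultimately show "poly ((pderiv ^^ l) Q) (\<zeta> j) = 0"
      using J(3)[OF j] by (metis has_nontangential_limit_unique)
  qed
  then have "A dvd Q"
    unfolding A by (intro prod_linear_power_dvd J)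
  then have "Q = 0"
    by (rule eq_0_if_dvd_small) (simp add: Q_def)
  then show "F = 0"
    using AF inv by (simp add: self_inversive_def)
qed

text \<open>One Gram-Schmidt step per induction: both the new vector and \<open>v\<close> are
  reduced modulo the old family, and then the component along the reduced new vector is removed. The
  family may be linearly dependent.\<close>

lemma finite_family_orthogonal_residual:
  fixes u :: "'i \<Rightarrow> nat \<Rightarrow> complex" and v :: "nat \<Rightarrow> complex"
  assumes "finite I"
  shows "\<exists>\<alpha>. \<forall>i\<in>I. (\<Sum>n<N. (v n - (\<Sum>k\<in>I. \<alpha> k * u k n)) * cnj (u i n)) = 0"
  using assms
proof (induction I arbitrary: v)
  case (insert s I)
  from insert.IH[of "u s"] obtain \<beta> where
    \<beta>: "\<And>i. i \<in> I \<Longrightarrow> (\<Sum>n<N. (u s n - (\<Sum>k\<in>I. \<beta> k * u k n)) * cnj (u i n)) = 0" by blast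
  from insert.IH[of v] obtain \<gamma> where
    \<gamma>: "\<And>i. i \<in> I \<Longrightarrow> (\<Sum>n<N. (v n - (\<Sum>k\<in>I. \<gamma> k * u k n)) * cnj (u i n)) = 0" by blast
  define s' where "s' n = u s n - (\<Sum>k\<in>I. \<beta> k * u k n)" for n
  define v' where "v' n = v n - (\<Sum>k\<in>I. \<gamma> k * u k n)" for n
  \<comment> \<open>If \<open>s'\<close> vanishes below \<open>N\<close>, the quotient is a division
    by 0 with value 0; every \<open>t\<close> would do in that case.\<close>
  define t where "t = (\<Sum>n<N. v' n * cnj (s' n)) / (\<Sum>n<N. s' n * cnj (s' n))"
  have t: "(\<Sum>n<N. (v' n - t * s' n) * cnj (s' n)) = 0"
  proof (cases "(\<Sum>n<N. s' n * cnj (s' n)) = 0")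
    case True
    then have "of_real (\<Sum>n<N. (norm (s' n))\<^sup>2) = (0 :: complex)"
      by (simp only: of_real_sum complex_norm_square)
    then have "(\<Sum>n<N. (norm (s' n))\<^sup>2) = 0"
      by (simp only: of_real_eq_0_iff)
    then have "s' n = 0" if "n < N" for n
      using that by (simp add: sum_nonneg_eq_0_iff)
    then show ?thesis by (intro sum.neutral) simp
  next
    case False
    then have "t * (\<Sum>n<N. s' n * cnj (s' n)) = (\<Sum>n<N. v' n * cnj (s' n))"
      by (simp add: t_def)
    then show ?thesis
      by (simp add: left_diff_distrib sum_subtractf mult.assoc flip: sum_distrib_left)
  qed
  define \<alpha> where "\<alpha> k = (if k = s then t else \<gamma> k - t * \<beta> k)" for k
  have res: "v n - (\<Sum>k\<in>insert s I. \<alpha> k * u k n) = v' n - t * s' n" for n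
  proof -
    have "(\<Sum>k\<in>I. \<alpha> k * u k n) = (\<Sum>k\<in>I. \<gamma> k * u k n - t * (\<beta> k * u k n))"
      using insert.hyps by (intro sum.cong) (auto simp: \<alpha>_def algebra_simps)
    then show ?thesis
      using insert.hyps by (simp add: \<alpha>_def v'_def s'_def sum_subtractf sum_distrib_left algebra_simps)
  qed
  have orth: "(\<Sum>n<N. (v' n - t * s' n) * cnj (u i n)) = 0" if "i \<in> I" for i
    using \<beta>[OF that] \<gamma>[OF that] unfolding v'_def[symmetric] s'_def[symmetric]
    by (simp add: left_diff_distrib sum_subtractf mult.assoc flip: sum_distrib_left)
  \<comment> \<open>The original vector \<open>u s\<close> is \<open>s'\<close> plus a combination
    of the old family, and the residual is orthogonal to both.\<close>
  have "(\<Sum>n<N. (v' n - t * s' n) * cnj (u s n)) =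
      (\<Sum>n<N. (v' n - t * s' n) * cnj (s' n)) +
      (\<Sum>k\<in>I. cnj (\<beta> k) * (\<Sum>n<N. (v' n - t * s' n) * cnj (u k n)))"
  proof -
    have "cnj (u s n) = cnj (s' n) + (\<Sum>k\<in>I. cnj (\<beta> k) * cnj (u k n))" for n
      by (simp add: s'_def)
    then show ?thesis
      by (simp add: distrib_left sum.distrib sum_distrib_left mult_ac sum.swap[of _ I])
  qed
  then have "(\<Sum>n<N. (v' n - t * s' n) * cnj (u s n)) = 0"
    using t orth by simp
  with orth show ?case
    by (intro exI[of _ \<alpha>] ballI) (auto simp only: res insert_iff)
qed simp

section \<open>Kernels and the orthogonal decomposition\<close>

lemma toeplitz_cnj_poly_inj_on:
  assumes inj: "\<And>F. sq_summable F \<Longrightarrow> conj_toeplitz A F = 0 \<Longrightarrow> F = 0"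
  shows "inj_on (toeplitz (\<lambda>z. cnj (poly A z))) H2"
  unfolding H2_eq
proof (intro inj_onI, elim imageE CollectE, hypsubst)
  fix F G assume F: "sq_summable F" and G: "sq_summable G"
    and "toeplitz (\<lambda>z. cnj (poly A z)) (hardy F) = toeplitz (\<lambda>z. cnj (poly A z)) (hardy G)"
  then have "conj_toeplitz A (F - G) = 0"
    by (simp add: toeplitz_cnj_poly hardy_eq_iff sq_summable_conj_toeplitz conj_toeplitz_diff)
  moreover have "sq_summable (F - G)"
    using sq_summable_add[OF F sq_summable_cmult[OF G, of "-1"]] by (simp flip: fps_const_neg)
  ultimately show "hardy F = hardy G"
    using inj[of "F - G"] by simp
qed

lemma toeplitz_range_cnj_poly:
  "toeplitz_range (\<lambda>z. cnj (poly A z)) = (\<lambda>F. hardy (conj_toeplitz A F)) ` {F. sq_summable F}"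
  unfolding toeplitz_range_def H2_eq image_image by (auto simp: toeplitz_cnj_poly)

lemma toeplitz_range_inner_hardy:
  assumes inj: "\<And>F. sq_summable F \<Longrightarrow> conj_toeplitz A F = 0 \<Longrightarrow> F = 0"
    and "sq_summable F" "sq_summable G"
  shows "toeplitz_range_inner (\<lambda>z. cnj (poly A z)) (hardy (conj_toeplitz A F)) (hardy (conj_toeplitz A G)) =
    H2_inner (hardy F) (hardy G)"
proof -
  have "the_inv_into H2 (toeplitz (\<lambda>z. cnj (poly A z))) (hardy (conj_toeplitz A F)) = hardy F"
    if "sq_summable F" for F
    using that
    by (subst toeplitz_cnj_poly[symmetric]) (auto intro!: the_inv_into_f_f toeplitz_cnj_poly_inj_on inj hardy_in_H2)
  then show ?thesis
    using assms(2,3) by (simp add: toeplitz_range_inner_def)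
qed

text \<open>The preimage of the kernel under the Toeplitz operator, read off from the values of the
  functional on the images of the monomials.\<close>

definition kernel_preimage :: "complex \<Rightarrow> complex poly \<Rightarrow> complex \<Rightarrow> nat \<Rightarrow> complex poly" where
  "kernel_preimage \<kappa> A \<zeta> l = (\<Sum>i<degree A.
     monom (cnj (poly ((pderiv ^^ l) (conj_toeplitz_poly \<kappa> A (monom 1 i))) \<zeta>)) i)"

lemma coeff_kernel_preimage:
  "coeff (kernel_preimage \<kappa> A \<zeta> l) i =
    (if i < degree A then cnj (poly ((pderiv ^^ l) (conj_toeplitz_poly \<kappa> A (monom 1 i))) \<zeta>) else 0)"
  by (simp add: kernel_preimage_def coeff_sum)

lemma conj_toeplitz_poly_add:
  "conj_toeplitz_poly \<kappa> A (P + Q) = conj_toeplitz_poly \<kappa> A P + conj_toeplitz_poly \<kappa> A Q"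
  by (rule poly_eqI) (simp add: conj_toeplitz_poly_def coeff_poly_shift algebra_simps)

lemma conj_toeplitz_poly_smult:
  "conj_toeplitz_poly \<kappa> A (smult c P) = smult c (conj_toeplitz_poly \<kappa> A P)"
  by (rule poly_eqI) (simp add: conj_toeplitz_poly_def coeff_poly_shift)

lemma conj_toeplitz_poly_0 [simp]: "conj_toeplitz_poly \<kappa> A 0 = 0"
  by (simp add: conj_toeplitz_poly_def)

text \<open>By linearity the functional is determined by its values on monomials, which are the
  conjugated coefficients of \<open>kernel_preimage\<close>.\<close>

lemma higher_pderiv_conj_toeplitz_poly:
  assumes P: "\<And>i. i \<ge> degree A \<Longrightarrow> coeff P i = 0"
  shows "poly ((pderiv ^^ l) (conj_toeplitz_poly \<kappa> A P)) \<zeta> =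
    (\<Sum>i<degree A. coeff P i * cnj (coeff (kernel_preimage \<kappa> A \<zeta> l) i))"
proof -
  have *: "poly ((pderiv ^^ l) (conj_toeplitz_poly \<kappa> A (\<Sum>i<N. smult (c i) (monom 1 i)))) \<zeta> =
      (\<Sum>i<N. c i * poly ((pderiv ^^ l) (conj_toeplitz_poly \<kappa> A (monom 1 i))) \<zeta>)" for N c
    by (induction N) (simp_all add: conj_toeplitz_poly_add conj_toeplitz_poly_smult
        higher_pderiv_add higher_pderiv_smult del: smult_monom)
  have "P = (\<Sum>i<degree A. smult (coeff P i) (monom 1 i))"
    using P by (intro poly_eqI) (simp add: coeff_sum smult_monom not_less)
  then have "poly ((pderiv ^^ l) (conj_toeplitz_poly \<kappa> A P)) \<zeta> =
      (\<Sum>i<degree A. coeff P i * poly ((pderiv ^^ l) (conj_toeplitz_poly \<kappa> A (monom 1 i))) \<zeta>)"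
    using *[where N = "degree A" and c = "coeff P"] by (simp del: smult_monom)
  then show ?thesis by (simp add: coeff_kernel_preimage)
qed

lemma H2_inner_fps_of_poly_right:
  assumes "sq_summable F" "\<And>i. i \<ge> N \<Longrightarrow> coeff P i = 0"
  shows "H2_inner (hardy F) (hardy (fps_of_poly P)) = (\<Sum>n<N. F $ n * cnj (coeff P n))"
  using H2_inner_finite_right[OF assms(1), of N "fps_of_poly P"] assms(2) by simp

text \<open>By \<open>conj_toeplitz_split\<close> the functional depends only on the first
  \<open>degree A\<close> coefficients of the preimage, so a polynomial represents it. For
  uniqueness, a competitor is tested on the images of the monomials, which fixes every coefficient
  of its preimage.\<close>

lemma boundary_kernel_eq:
  assumes inv: "self_inversive \<kappa> A"
    and inj: "\<And>F. sq_summable F \<Longrightarrow> conj_toeplitz A F = 0 \<Longrightarrow> F = 0"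
    and \<zeta>: "norm \<zeta> = 1" and dvd: "[:-\<zeta>, 1:] ^ m dvd A" and l: "l < m"
  shows "boundary_kernel (\<lambda>z. cnj (poly A z)) \<zeta> l =
    hardy (conj_toeplitz A (fps_of_poly (kernel_preimage \<kappa> A \<zeta> l)))"
  unfolding boundary_kernel_def
proof (rule the_equality)
  let ?U = "fps_of_poly (kernel_preimage \<kappa> A \<zeta> l)"
  let ?ip = "toeplitz_range_inner (\<lambda>z. cnj (poly A z))"
  have U: "sq_summable ?U" by (rule sq_summable_fps_of_poly)
  have lim: "has_nontangential_limit ((deriv ^^ l) (hardy (conj_toeplitz A F)))
      (?ip (hardy (conj_toeplitz A F)) (hardy (conj_toeplitz A ?U))) \<zeta>" if F: "sq_summable F" for F
  proof -
    let ?P = "truncate_fps (degree A) F"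
    have "?ip (hardy (conj_toeplitz A F)) (hardy (conj_toeplitz A ?U)) = H2_inner (hardy F) (hardy ?U)"
      by (rule toeplitz_range_inner_hardy[OF inj F U])
    also have "\<dots> = (\<Sum>i<degree A. F $ i * cnj (coeff (kernel_preimage \<kappa> A \<zeta> l) i))"
      by (rule H2_inner_fps_of_poly_right[OF F]) (simp add: coeff_kernel_preimage)
    also have "\<dots> = poly ((pderiv ^^ l) (conj_toeplitz_poly \<kappa> A ?P)) \<zeta>"
      by (subst higher_pderiv_conj_toeplitz_poly) auto
    finally show ?thesis
      using F by (simp add: conj_toeplitz_split[OF inv, of F]
          has_nontangential_limit_higher_deriv_mult_add_poly[OF _ \<zeta> dvd l] sq_summable_cmult sq_summable_shift_iff)
  qed
  then show "hardy (conj_toeplitz A ?U) \<in> toeplitz_range (\<lambda>z. cnj (poly A z)) \<and>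
      (\<forall>f\<in>toeplitz_range (\<lambda>z. cnj (poly A z)).
        has_nontangential_limit ((deriv ^^ l) f) (?ip f (hardy (conj_toeplitz A ?U))) \<zeta>)"
    using U by (auto simp: toeplitz_range_cnj_poly)
  fix k assume k: "k \<in> toeplitz_range (\<lambda>z. cnj (poly A z)) \<and>
      (\<forall>f\<in>toeplitz_range (\<lambda>z. cnj (poly A z)). has_nontangential_limit ((deriv ^^ l) f) (?ip f k) \<zeta>)"
  then obtain K where K: "sq_summable K" "k = hardy (conj_toeplitz A K)"
    by (auto simp: toeplitz_range_cnj_poly)
  have "K $ n = ?U $ n" for n
  proof -
    let ?X = "fps_of_poly (monom 1 n) :: complex fps"
    have X: "sq_summable ?X" by (rule sq_summable_fps_of_poly)
    have "?ip (hardy (conj_toeplitz A ?X)) k = ?ip (hardy (conj_toeplitz A ?X)) (hardy (conj_toeplitz A ?U))"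
      using k X lim[OF X] \<zeta> by (intro has_nontangential_limit_unique[of "(deriv ^^ l) (hardy (conj_toeplitz A ?X))" _ \<zeta>])
        (auto simp: toeplitz_range_cnj_poly)
    then have "H2_inner (hardy ?X) (hardy K) = H2_inner (hardy ?X) (hardy ?U)"
      unfolding K(2) by (simp only: toeplitz_range_inner_hardy[OF inj X K(1)] toeplitz_range_inner_hardy[OF inj X U])
    \<comment> \<open>The finite sum formula requires the polynomial in the second argument.\<close>
    then have "H2_inner (hardy K) (hardy ?X) = H2_inner (hardy ?U) (hardy ?X)"
      by (metis H2_inner_commute)
    moreover have "H2_inner (hardy G) (hardy ?X) = G $ n" if "sq_summable G" for G
      using that by (subst H2_inner_fps_of_poly_right[of _ "Suc n"]) auto
    ultimately show ?thesis using K(1) U by simp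
  qed
  then have "K = ?U" by (intro fps_ext)
  with K show "k = hardy (conj_toeplitz A ?U)" by simp
qed

text \<open>Instead of counting dimensions, a polynomial is projected onto the span of the kernel
  preimages. The residual is orthogonal to all of them, so its image is divisible by
  \<open>A\<close> and of smaller degree; hence it is 0, and injectivity removes the
  residual.\<close>

lemma complex_span_kernels:
  assumes inv: "self_inversive \<kappa> A"
    and inj: "\<And>F. sq_summable F \<Longrightarrow> conj_toeplitz A F = 0 \<Longrightarrow> F = 0"
    and J: "finite J" "inj_on \<zeta> J" and A: "A = (\<Prod>j\<in>J. [:-\<zeta> j, 1:] ^ m j)"
  shows "complex_span {hardy (conj_toeplitz A (fps_of_poly (kernel_preimage \<kappa> A (\<zeta> j) l))) |j l. j \<in> J \<and> l < m j} =
    {hardy (conj_toeplitz A (fps_of_poly P)) |P. \<forall>i\<ge>degree A. coeff P i = 0}"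
    (is "complex_span ?K = ?W")
proof -
  interpret fs: module "\<lambda>c (f :: complex \<Rightarrow> complex) z. c * f z"
    by unfold_locales (auto simp: fun_eq_iff algebra_simps)
  note sq = sq_summable_conj_toeplitz[OF sq_summable_fps_of_poly]
  have add: "hardy (conj_toeplitz A (fps_of_poly (P + Q))) =
      hardy (conj_toeplitz A (fps_of_poly P)) + hardy (conj_toeplitz A (fps_of_poly Q))" for P Q
    by (simp add: fps_of_poly_add conj_toeplitz_add hardy_add sq)
  have smult: "hardy (conj_toeplitz A (fps_of_poly (smult c P))) =
      (\<lambda>z. c * hardy (conj_toeplitz A (fps_of_poly P)) z)" for c P
    by (simp add: fps_of_poly_smult conj_toeplitz_cmult hardy_cmult sq)
  have zero: "hardy (conj_toeplitz A (fps_of_poly 0)) = 0"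
    by (simp add: conj_toeplitz_def hardy_0)
  have "fs.span ?K = ?W"
  proof (rule equalityI)
    have "fs.subspace ?W"
      unfolding fs.subspace_def
    proof (intro conjI ballI allI)
      show "0 \<in> ?W" by (intro CollectI exI[of _ 0]) (simp add: zero[symmetric])
    next
      fix f g assume "f \<in> ?W" "g \<in> ?W"
      then obtain P Q where "f = hardy (conj_toeplitz A (fps_of_poly P))" "g = hardy (conj_toeplitz A (fps_of_poly Q))"
        "\<forall>i\<ge>degree A. coeff P i = 0" "\<forall>i\<ge>degree A. coeff Q i = 0" by blast
      then show "f + g \<in> ?W" by (intro CollectI exI[of _ "P + Q"]) (simp add: add)
    next
      fix c f assume "f \<in> ?W"
      then obtain P where "f = hardy (conj_toeplitz A (fps_of_poly P))" "\<forall>i\<ge>degree A. coeff P i = 0" by blast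
      then show "(\<lambda>z. c * f z) \<in> ?W" by (intro CollectI exI[of _ "smult c P"]) (simp add: smult)
    qed
    moreover have "?K \<subseteq> ?W"
    proof
      fix f assume "f \<in> ?K"
      then obtain j l where "f = hardy (conj_toeplitz A (fps_of_poly (kernel_preimage \<kappa> A (\<zeta> j) l)))" by blast
      then show "f \<in> ?W"
        by (intro CollectI exI[of _ "kernel_preimage \<kappa> A (\<zeta> j) l"]) (simp add: coeff_kernel_preimage)
    qed
    ultimately show "fs.span ?K \<subseteq> ?W" by (rule fs.span_minimal[rotated])
  next
    define I where "I = Sigma J (\<lambda>j. {..<m j})"
    define u where "u = (\<lambda>(j, l). kernel_preimage \<kappa> A (\<zeta> j) l)"
    have "finite I" using J by (simp add: I_def)
    have u_base: "hardy (conj_toeplitz A (fps_of_poly (u i))) \<in> ?K" if "i \<in> I" for i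
      using that by (auto simp: I_def u_def)
    have in_span: "hardy (conj_toeplitz A (fps_of_poly (\<Sum>i\<in>I'. smult (\<alpha> i) (u i)))) \<in> fs.span ?K"
      if "I' \<subseteq> I" for I' \<alpha>
      using finite_subset[OF that \<open>finite I\<close>] that
    proof induction
      case empty
      then show ?case using fs.span_zero by (simp only: sum.empty zero)
    next
      case (insert i I')
      then have "i \<in> I" and "hardy (conj_toeplitz A (fps_of_poly (\<Sum>i\<in>I'. smult (\<alpha> i) (u i)))) \<in> fs.span ?K"
        by blast+
      then show ?case
        unfolding sum.insert[OF insert.hyps] add smult
        by (intro fs.span_add[OF fs.span_scale[OF fs.span_base[OF u_base]]])
    qed
    show "?W \<subseteq> fs.span ?K"
    proof
      fix f assume "f \<in> ?W"
      then obtain P where f: "f = hardy (conj_toeplitz A (fps_of_poly P))"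
        and P: "\<And>i. i \<ge> degree A \<Longrightarrow> coeff P i = 0" by blast
      obtain \<alpha> where \<alpha>: "\<And>i. i \<in> I \<Longrightarrow>
          (\<Sum>n<degree A. (coeff P n - (\<Sum>k\<in>I. \<alpha> k * coeff (u k) n)) * cnj (coeff (u i) n)) = 0"
        using finite_family_orthogonal_residual[OF \<open>finite I\<close>,
            where N = "degree A" and v = "coeff P" and u = "\<lambda>k n. coeff (u k) n"]
        by blast
      define R where "R = P - (\<Sum>k\<in>I. smult (\<alpha> k) (u k))"
      have R_coeff: "coeff R n = coeff P n - (\<Sum>k\<in>I. \<alpha> k * coeff (u k) n)" for n
        by (simp add: R_def coeff_sum)
      have R: "coeff R i = 0" if "i \<ge> degree A" for i
        using that P by (auto simp: R_coeff u_def coeff_kernel_preimage intro!: sum.neutral)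
      \<comment> \<open>Orthogonality of \<open>R\<close> to \<open>u (j, l)\<close> says exactly
        that the derivative of order \<open>l\<close> of its image vanishes at
        \<open>\<zeta> j\<close>.\<close>
      have "A dvd conj_toeplitz_poly \<kappa> A R"
        unfolding A[symmetric]
      proof (subst A, rule prod_linear_power_dvd[OF J])
        fix j assume j: "j \<in> J"
        show "[:-\<zeta> j, 1:] ^ m j dvd conj_toeplitz_poly \<kappa> A R"
        proof (rule linear_power_dvd_if_higher_pderiv_eq_0)
          fix l assume "l < m j"
          then show "poly ((pderiv ^^ l) (conj_toeplitz_poly \<kappa> A R)) (\<zeta> j) = 0"
            using \<alpha>[of "(j, l)"] j
            by (subst higher_pderiv_conj_toeplitz_poly[OF R]) (auto simp: R_coeff I_def u_def)
        qed
      qed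
      then have "conj_toeplitz_poly \<kappa> A R = 0"
        by (rule eq_0_if_dvd_small) (rule coeff_conj_toeplitz_poly_eq_0[OF R])
      then have "conj_toeplitz A (fps_of_poly R) = 0"
        by (simp add: conj_toeplitz_fps_of_poly[OF inv])
      then have "fps_of_poly R = 0"
        by (rule inj[OF sq_summable_fps_of_poly])
      then have "P = (\<Sum>k\<in>I. smult (\<alpha> k) (u k))"
        using fps_of_poly_eq_iff[of R 0] by (simp add: R_def)
      then show "f \<in> fs.span ?K"
        unfolding f using in_span[of I \<alpha>] by simp
    qed
  qed
  then show ?thesis by (simp add: complex_span_def)
qed

lemma multiplication_range_poly:
  "multiplication_range (poly A) = (\<lambda>H. hardy (fps_of_poly A * H)) ` {H. sq_summable H}"
  unfolding multiplication_range_def H2_eq image_image by (auto simp: hardy_mult_poly fun_eq_iff intro!: image_cong)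

theorem corollary5p16:
  fixes n :: nat and \<zeta> :: "nat \<Rightarrow> complex" and m :: "nat \<Rightarrow> nat" and a :: "complex \<Rightarrow> complex"
  assumes "n \<ge> 1"
    and "\<And>j. j \<in> {1..n} \<Longrightarrow> norm (\<zeta> j) = 1"
    and "inj_on \<zeta> {1..n}"
    and "\<And>j. j \<in> {1..n} \<Longrightarrow> m j \<ge> 1"
    and "a = (\<lambda>z. \<Prod>j=1..n. (z - \<zeta> j) ^ m j)"
  shows "is_orthogonal_sum (toeplitz_range_inner (\<lambda>z. cnj (a z)))
           (toeplitz_range (\<lambda>z. cnj (a z)))
           (multiplication_range a)
           (complex_span {boundary_kernel (\<lambda>z. cnj (a z)) (\<zeta> j) l |j l. j \<in> {1..n} \<and> l < m j})"
proof -
  define A where "A = (\<Prod>j=1..n. [:-\<zeta> j, 1:] ^ m j)"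
  have a: "a = poly A"
    by (simp add: assms(5) A_def poly_prod poly_power fun_eq_iff)
  obtain \<kappa> where inv: "self_inversive \<kappa> A"
    unfolding A_def using self_inversive_prod_linear[of "{1..n}" \<zeta>] assms(2) by blast
  then have "\<kappa> \<noteq> 0" by (simp add: self_inversive_def)
  have inj: "F = 0" if "sq_summable F" "conj_toeplitz A F = 0" for F
    using conj_toeplitz_eq_0_imp[OF inv _ assms(3,2) A_def that] by simp
  let ?N = "degree A" and ?T = "conj_toeplitz A"
  let ?ip = "toeplitz_range_inner (\<lambda>z. cnj (poly A z))"
  define S where "S = complex_span {boundary_kernel (\<lambda>z. cnj (poly A z)) (\<zeta> j) l |j l. j \<in> {1..n} \<and> l < m j}"
  have kernel: "boundary_kernel (\<lambda>z. cnj (poly A z)) (\<zeta> j) l = hardy (?T (fps_of_poly (kernel_preimage \<kappa> A (\<zeta> j) l)))"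
    if "j \<in> {1..n}" "l < m j" for j l
  proof (rule boundary_kernel_eq[OF inv inj assms(2)[OF that(1)] _ that(2)])
    show "[:- \<zeta> j, 1:] ^ m j dvd A"
      unfolding A_def using that(1) by (intro dvd_prodI) auto
  qed
  have "{boundary_kernel (\<lambda>z. cnj (poly A z)) (\<zeta> j) l |j l. j \<in> {1..n} \<and> l < m j} =
      {hardy (?T (fps_of_poly (kernel_preimage \<kappa> A (\<zeta> j) l))) |j l. j \<in> {1..n} \<and> l < m j}"
    using kernel by (intro Collect_cong) (metis (no_types, lifting))
  then have S: "S = {hardy (?T (fps_of_poly P)) |P. \<forall>i\<ge>?N. coeff P i = 0}"
    unfolding S_def using complex_span_kernels[OF inv inj _ assms(3) A_def] by simp
  \<comment> \<open>\<open>G H\<close> is the preimage of \<open>A\<close> times \<open>H\<close>: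
    the shift by \<open>?N\<close> cancels the power of \<open>fps_X\<close>, and
    \<open>inverse \<kappa>\<close> cancels the scalar.\<close>
  define G where "G H = fps_const (inverse \<kappa>) * (fps_X ^ ?N * H)" for H
  have G_sq: "sq_summable (G H)" if "sq_summable H" for H
    unfolding G_def using that by (intro sq_summable_cmult sq_summable_fps_X_power_mult)
  \<comment> \<open>Preimages of multiples of \<open>A\<close> start at index \<open>?N\<close>,
    whereas preimages of elements of \<open>S\<close> stop before it. Trivial intersection and
    orthogonality both rest on this.\<close>
  have G_low: "G H $ i = 0" if "i < ?N" for H i
    using that by (simp add: G_def fps_X_power_mult_nth)
  have T_G: "?T (G H) = fps_of_poly A * H" for H
  proof -
    have "?T (fps_X ^ ?N * H) = fps_const \<kappa> * fps_shift ?N (fps_of_poly A * H * fps_X ^ ?N)"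
      by (simp only: conj_toeplitz_eq_shift[OF inv] mult_ac)
    then have T: "?T (fps_X ^ ?N * H) = fps_const \<kappa> * (fps_of_poly A * H)"
      by (simp add: fps_shift_times_fps_X_power')
    have "?T (G H) = fps_const (inverse \<kappa>) * (fps_const \<kappa> * (fps_of_poly A * H))"
      by (simp only: G_def conj_toeplitz_cmult T)
    then show ?thesis
      using \<open>\<kappa> \<noteq> 0\<close> by (simp flip: mult.assoc)
  qed
  have range: "toeplitz_range (\<lambda>z. cnj (poly A z)) = {f + g |f g. f \<in> multiplication_range (poly A) \<and> g \<in> S}"
  proof (intro equalityI subsetI)
    fix f assume "f \<in> toeplitz_range (\<lambda>z. cnj (poly A z))"
    then obtain F where F: "sq_summable F" "f = hardy (?T F)"
      by (auto simp: toeplitz_range_cnj_poly)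
    let ?H = "fps_const \<kappa> * fps_shift ?N F" and ?P = "truncate_fps ?N F"
    have H: "sq_summable ?H"
      using F by (intro sq_summable_cmult) (simp add: sq_summable_shift_iff)
    have "f = hardy (fps_of_poly A * ?H) + hardy (?T (fps_of_poly ?P))"
      unfolding F(2) conj_toeplitz_fps_of_poly[OF inv] conj_toeplitz_split[OF inv, of F]
      by (intro hardy_add sq_summable_poly_mult H sq_summable_fps_of_poly)
    moreover have "hardy (?T (fps_of_poly ?P)) \<in> S"
      unfolding S by (intro CollectI exI[of _ ?P]) simp
    ultimately show "f \<in> {f + g |f g. f \<in> multiplication_range (poly A) \<and> g \<in> S}"
      using H by (auto simp: multiplication_range_poly)
  next
    fix f assume "f \<in> {f + g |f g. f \<in> multiplication_range (poly A) \<and> g \<in> S}"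
    then obtain H P where H: "sq_summable H"
      and f: "f = hardy (fps_of_poly A * H) + hardy (?T (fps_of_poly P))"
      by (auto simp: multiplication_range_poly S)
    have sq: "sq_summable (G H + fps_of_poly P)"
      by (intro sq_summable_add G_sq H sq_summable_fps_of_poly)
    have "f = hardy (?T (G H + fps_of_poly P))"
      unfolding conj_toeplitz_add T_G f
      by (intro hardy_add[symmetric] sq_summable_poly_mult H sq_summable_conj_toeplitz sq_summable_fps_of_poly)
    with sq show "f \<in> toeplitz_range (\<lambda>z. cnj (poly A z))"
      by (auto simp: toeplitz_range_cnj_poly)
  qed
  have inter: "multiplication_range (poly A) \<inter> S = {0}"
  proof (intro equalityI subsetI)
    fix f assume "f \<in> multiplication_range (poly A) \<inter> S"
    then obtain H P where H: "sq_summable H" "f = hardy (?T (G H))"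
      and P: "f = hardy (?T (fps_of_poly P))" "\<And>i. i \<ge> ?N \<Longrightarrow> coeff P i = 0"
      by (auto simp: multiplication_range_poly S T_G)
    \<comment> \<open>Injectivity turns the two representations of \<open>f\<close> into equal
      preimages, which have disjoint supports and are therefore 0.\<close>
    have "?T (G H) = ?T (fps_of_poly P)"
      using H P(1) by (simp add: hardy_eq_iff sq_summable_conj_toeplitz G_sq sq_summable_fps_of_poly)
    then have "?T (G H - fps_of_poly P) = 0"
      by (simp add: conj_toeplitz_diff)
    moreover have "sq_summable (G H - fps_of_poly P)"
      using sq_summable_add[OF G_sq[OF H(1)] sq_summable_fps_of_poly[of "- P"]]
      by (simp add: fps_of_poly_uminus)
    ultimately have eq: "G H = fps_of_poly P"
      using inj by force
    have "coeff P i = 0" for i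
    proof (cases "i < ?N")
      case True
      then show ?thesis using G_low[OF True, of H] unfolding eq by simp
    qed (use P in simp)
    then have "P = 0" by (simp add: poly_eq_iff)
    then show "f \<in> {0}"
      using P(1) by (simp add: conj_toeplitz_def hardy_0)
  next
    fix f :: "complex \<Rightarrow> complex" assume "f \<in> {0}"
    moreover have "0 \<in> multiplication_range (poly A)"
      unfolding multiplication_range_poly
      by (rule image_eqI[of _ _ 0]) (simp_all add: hardy_0 sq_summable_0)
    moreover have "0 \<in> S"
      unfolding S by (intro CollectI exI[of _ 0]) (simp add: conj_toeplitz_def hardy_0)
    ultimately show "f \<in> multiplication_range (poly A) \<inter> S"
      by simp
  qed
  have "?ip f g = 0" if f: "f \<in> multiplication_range (poly A)" and g: "g \<in> S" for f g
  proof -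
    from f obtain H where H: "sq_summable H" "f = hardy (?T (G H))"
      by (auto simp: multiplication_range_poly T_G)
    from g obtain P where P: "g = hardy (?T (fps_of_poly P))" "\<And>i. i \<ge> ?N \<Longrightarrow> coeff P i = 0"
      by (auto simp: S)
    \<comment> \<open>The range inner product is pulled back to the preimages, and in the resulting
      sum only indices below \<open>?N\<close> occur.\<close>
    have "?ip f g = H2_inner (hardy (G H)) (hardy (fps_of_poly P))"
      unfolding H(2) P(1) by (rule toeplitz_range_inner_hardy[OF inj G_sq[OF H(1)] sq_summable_fps_of_poly])
    also have "\<dots> = (\<Sum>i<?N. G H $ i * cnj (coeff P i))"
      by (rule H2_inner_fps_of_poly_right[OF G_sq[OF H(1)] P(2)])
    also have "\<dots> = 0"
      by (rule sum.neutral) (simp add: G_low)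
    finally show ?thesis .
  qed
  then show ?thesis
    unfolding is_orthogonal_sum_def a S_def[symmetric] by (intro conjI range inter ballI)
qed

end
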